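(* Let $f:\mathbb{R}_+\to\mathbb{R}$ be a monotone increasing function such that $f(0)=0$. Then for any $A\in\mathbf{H}_+^n$, $M\in\mathbb{C}^{n\times n}$ and any integer $1\le k\le n$, $$\sum_{i=1}^k\lambda_i^{\uparrow}\big(f(M^*AM)\big)=\inf_{\substack{G\in\mathbb{C}^{n\times n},\ G^2=G\\ \mathrm{rank}(G)=k}}\mathrm{Tr}\big[f(M^*G^*AGM)\big].$$ Moreover, if $M$ is invertible, the infimum can be achieved.
   Context: $\mathbb{R}_+=[0,+\infty)$. $\mathbf{H}_+^n$ is the cone of $n\times n$ complex Hermitian positive semidefinite matrices. For a Hermitian matrix $X$, $\lambda_i^{\uparrow}(X)$ denotes its $i$-th smallest eigenvalue (counted with multiplicity). For a scalar function $f$, $f(X)=\sum_i f(\lambda_i(X))u_iu_i^*$, where $u_1,\dots,u_n$ are corresponding orthonormal eigenvectors of $X$. The matrices $G$ in the infimum are idempotent, not necessarily Hermitian. *)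

theory Defs
  imports
    Complex_Main
    "Jordan_Normal_Form.Char_Poly"
    "Jordan_Normal_Form.Schur_Decomposition"
    "Jordan_Normal_Form.DL_Rank"
    "HOL-Computational_Algebra.Fundamental_Theorem_Algebra"
begin

definition mat_trace :: "complex mat \<Rightarrow> complex" where
  "mat_trace X = (\<Sum>i<dim_row X. X $$ (i, i))"

definition hermitian_psd :: "nat \<Rightarrow> complex mat set" where
  "hermitian_psd n =
     {X \<in> carrier_mat n n. mat_adjoint X = X \<and> (\<forall>v \<in> carrier_vec n. 0 \<le> (X *\<^sub>v v) \<bullet>c v)}"

text \<open>The \<open>i\<close>-th smallest eigenvalue, \<open>i\<close> counted from 1, of a Hermitian matrix.
  Eigenvalues are the roots of the characteristic polynomial with their multiplicities;
  they are real for Hermitian matrices, so taking real parts loses nothing there.\<close>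

definition eigval_up :: "complex mat \<Rightarrow> nat \<Rightarrow> real" where
  "eigval_up X i = sorted_list_of_multiset (image_mset Re (proots (char_poly X))) ! (i - 1)"

definition orthonormal_eigenbasis ::
  "complex mat \<Rightarrow> (nat \<Rightarrow> real) \<Rightarrow> (nat \<Rightarrow> complex vec) \<Rightarrow> bool" where
  "orthonormal_eigenbasis X l u \<longleftrightarrow>
     (\<forall>i<dim_row X. u i \<in> carrier_vec (dim_row X) \<and> X *\<^sub>v u i = complex_of_real (l i) \<cdot>\<^sub>v u i) \<and>
     (\<forall>i<dim_row X. \<forall>j<dim_row X. u i \<bullet>c u j = (if i = j then 1 else 0))"

text \<open>\<open>mat_fun f X\<close> is \<open>\<Sum>i. f (l i) u\<^sub>i u\<^sub>i\<^sup>*\<close>, written entrywise. For Hermitian \<open>X\<close> an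
  eigenbasis exists and the sum does not depend on its choice.\<close>

definition mat_fun :: "(real \<Rightarrow> real) \<Rightarrow> complex mat \<Rightarrow> complex mat" where
  "mat_fun f X = (SOME Y. \<exists>l u. orthonormal_eigenbasis X l u \<and>
     Y = mat (dim_row X) (dim_row X)
       (\<lambda>(r, c). \<Sum>i<dim_row X. complex_of_real (f (l i)) * (u i $ r * cnj (u i $ c))))"

definition rank_idempotents :: "nat \<Rightarrow> nat \<Rightarrow> complex mat set" where
  "rank_idempotents n k = {G \<in> carrier_mat n n. G * G = G \<and> vec_space.rank n G = k}"

end

theory Submission
  imports Defs
begin

text \<open>
  Put \<open>X = M\<^sup>* A M\<close>, with eigenvalues \<open>l 0 \<le> \<dots> \<le> l (n - 1)\<close> and orthonormal eigenvectors
  \<open>u 0, \<dots>, u (n - 1)\<close>, and for an idempotent \<open>G\<close> of rank \<open>k\<close> put \<open>Y = (G M)\<^sup>* A (G M)\<close>, with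
  eigenvalues \<open>m 0 \<le> \<dots> \<le> m (n - 1)\<close>. All these eigenvalues are nonnegative. As \<open>f\<close> keeps their
  order, the left-hand side is \<open>\<Sum>i<k. f (l i)\<close>, while the trace for \<open>G\<close> is \<open>\<Sum>i<n. f (m i)\<close>; the choice
  hidden in \<open>mat_fun\<close> is harmless because the characteristic polynomial determines the eigenvalues
  (\<open>mat_fun_eigenvalues\<close>, \<open>eigval_up_mat_fun\<close>).

  Lower bound. The vectors \<open>x\<close> with \<open>M x\<close> in the range of \<open>G\<close> form a space of dimension at least \<open>k\<close>,
  singular \<open>M\<close> included, and on it \<open>G M x = M x\<close>, so that \<open>X\<close> and \<open>Y\<close> have the same quadratic form there.
  A dimension count in the style of Cauchy interlacing gives \<open>l j \<le> m (n - k + j)\<close> for \<open>j < k\<close>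
  (\<open>eigenvalue_interlacing\<close>). Apply \<open>f\<close> and sum; the other \<open>n - k\<close> values \<open>f (m i)\<close> are at
  least \<open>f 0 = 0\<close> (\<open>compressed_eigenvalue_sum_le\<close>).

  A minimiser. Let \<open>P\<close> be the orthogonal projection onto the span of \<open>u 0, \<dots>, u (k - 1)\<close>. If
  \<open>G M = M P\<close>, then \<open>Y = P X P\<close> has the eigenvalues \<open>l 0, \<dots>, l (k - 1)\<close> and \<open>n - k\<close> zeros, so that the
  trace is exactly \<open>\<Sum>i<k. f (l i)\<close> (\<open>compressed_eigenvalue_sum_attained\<close>). For invertible \<open>M\<close> the
  matrix \<open>G = M P M\<^sup>-\<^sup>1\<close> does this. A singular \<open>M\<close> cannot be reached from there by a limit, since \<open>f\<close> may
  jump. Instead, the singular value decomposition gives an invertible \<open>N\<close> that coincides with \<open>M\<close> on the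
  orthogonal complement of the kernel of \<open>M\<close>. That kernel consists of null vectors of \<open>X\<close>, so the
  eigenvectors can be chosen such that each of them lies in the kernel or is orthogonal to it
  (\<open>adapted_eigenbasis\<close>). With this choice \<open>G = N P N\<^sup>-\<^sup>1\<close> satisfies \<open>G M = M P\<close>
  (\<open>idempotent_selecting_eigenvectors\<close>).
\<close>

section \<open>Inner products, adjoints and homogeneous systems\<close>

lemma cscalar_sum:
  fixes v w :: "complex vec"
  assumes "w \<in> carrier_vec n"
  shows "v \<bullet>c w = (\<Sum>i<n. v $ i * cnj (w $ i))"
  using assms by (simp add: scalar_prod_def lessThan_atLeast0)

lemma mult_mat_vec_sum:
  assumes "X \<in> carrier_mat m n" "v \<in> carrier_vec n" "r < m"
  shows "(X *\<^sub>v v) $ r = (\<Sum>s<n. X $$ (r, s) * v $ s)"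
  using assms by (simp add: scalar_prod_def lessThan_atLeast0)

lemma mult_mat_zero_vec:
  fixes X :: "'a::semiring_0 mat"
  assumes "X \<in> carrier_mat m n"
  shows "X *\<^sub>v 0\<^sub>v n = 0\<^sub>v m"
  using assms by auto

lemma mat_adjoint_dim [simp]:
  "dim_row (mat_adjoint X) = dim_col X" "dim_col (mat_adjoint X) = dim_row X"
  unfolding mat_adjoint_def by simp_all

lemma mat_adjoint_carrier: "X \<in> carrier_mat m n \<Longrightarrow> mat_adjoint X \<in> carrier_mat n m"
  by (intro carrier_matI) simp_all

lemma mat_adjoint_index:
  fixes X :: "complex mat"
  assumes "X \<in> carrier_mat m n" "i < n" "j < m"
  shows "mat_adjoint X $$ (i, j) = cnj (X $$ (j, i))"
  using assms unfolding mat_adjoint_def by (auto simp: mat_of_rows_def)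

lemma mat_adjoint_mult:
  fixes X Y :: "complex mat"
  assumes X: "X \<in> carrier_mat m n" and Y: "Y \<in> carrier_mat n p"
  shows "mat_adjoint (X * Y) = mat_adjoint Y * mat_adjoint X"
proof (rule eq_matI)
  have XY: "X * Y \<in> carrier_mat m p" using X Y by simp
  fix i j assume "i < dim_row (mat_adjoint Y * mat_adjoint X)" "j < dim_col (mat_adjoint Y * mat_adjoint X)"
  then have ij: "i < p" "j < m" using mat_adjoint_carrier[OF X] mat_adjoint_carrier[OF Y] by auto
  have *: "mat_adjoint Y $$ (i, k) = cnj (Y $$ (k, i))" "mat_adjoint X $$ (k, j) = cnj (X $$ (j, k))"
    if "k < n" for k
    using mat_adjoint_index[OF Y] mat_adjoint_index[OF X] ij that by auto
  have "(mat_adjoint Y * mat_adjoint X) $$ (i, j) = (\<Sum>k<n. mat_adjoint Y $$ (i, k) * mat_adjoint X $$ (k, j))"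
    using X Y ij
    by (simp add: scalar_prod_def lessThan_atLeast0)
  then show "mat_adjoint (X * Y) $$ (i, j) = (mat_adjoint Y * mat_adjoint X) $$ (i, j)"
    using ij X Y * by (simp add: mat_adjoint_index[OF XY] scalar_prod_def lessThan_atLeast0 mult.commute)
qed (use X Y in simp_all)

lemma mat_adjoint_adjoint:
  fixes X :: "complex mat"
  assumes X: "X \<in> carrier_mat m n"
  shows "mat_adjoint (mat_adjoint X) = X"
proof (rule eq_matI)
  fix i j assume "i < dim_row X" "j < dim_col X"
  then show "mat_adjoint (mat_adjoint X) $$ (i, j) = X $$ (i, j)"
    using X by (simp add: mat_adjoint_index[OF X] mat_adjoint_index[OF mat_adjoint_carrier[OF X]])
qed simp_all

lemma cscalar_adjoint:
  fixes X :: "complex mat"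
  assumes X: "X \<in> carrier_mat m n" and x: "x \<in> carrier_vec m" and y: "y \<in> carrier_vec n"
  shows "(mat_adjoint X *\<^sub>v x) \<bullet>c y = x \<bullet>c (X *\<^sub>v y)"
proof -
  have c: "X *\<^sub>v y \<in> carrier_vec m" using X y by simp
  have "(mat_adjoint X *\<^sub>v x) \<bullet>c y = (\<Sum>i<n. \<Sum>r<m. cnj (X $$ (r, i)) * x $ r * cnj (y $ i))"
    unfolding cscalar_sum[OF y]
    by (intro sum.cong) (auto simp: mult_mat_vec_sum[OF mat_adjoint_carrier[OF X] x] mat_adjoint_index[OF X] sum_distrib_right)
  also have "\<dots> = (\<Sum>r<m. \<Sum>i<n. cnj (X $$ (r, i)) * x $ r * cnj (y $ i))" by (rule sum.swap)
  also have "\<dots> = x \<bullet>c (X *\<^sub>v y)"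
    unfolding cscalar_sum[OF c]
    by (intro sum.cong) (auto simp: mult_mat_vec_sum[OF X y] sum_distrib_left mult_ac)
  finally show ?thesis .
qed

lemma cscalar_commute:
  fixes v w :: "complex vec"
  assumes "v \<in> carrier_vec n" "w \<in> carrier_vec n"
  shows "w \<bullet>c v = cnj (v \<bullet>c w)"
  unfolding cscalar_sum[OF assms(1)] cscalar_sum[OF assms(2)] by (simp add: mult.commute)

lemma cscalar_self:
  fixes v :: "complex vec"
  assumes "v \<in> carrier_vec n"
  shows "v \<bullet>c v = complex_of_real (\<Sum>i<n. (cmod (v $ i))\<^sup>2)"
  unfolding cscalar_sum[OF assms] of_real_sum
  by (intro sum.cong refl) (simp only: complex_norm_square)

lemma hermitian_cscalar:
  fixes X :: "complex mat"
  assumes "X \<in> carrier_mat n n" "mat_adjoint X = X" "x \<in> carrier_vec n" "y \<in> carrier_vec n"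
  shows "(X *\<^sub>v x) \<bullet>c y = x \<bullet>c (X *\<^sub>v y)"
  using cscalar_adjoint[OF assms(1,3,4)] assms(2) by simp

lemma cscalar_smult_left:
  fixes v w :: "complex vec"
  assumes "v \<in> carrier_vec n" "w \<in> carrier_vec n"
  shows "(a \<cdot>\<^sub>v v) \<bullet>c w = a * (v \<bullet>c w)"
  unfolding cscalar_sum[OF assms(2)] using assms by (simp add: sum_distrib_left mult.assoc)

lemma cscalar_smult_right:
  fixes v w :: "complex vec"
  assumes "v \<in> carrier_vec n" "w \<in> carrier_vec n"
  shows "v \<bullet>c (a \<cdot>\<^sub>v w) = cnj a * (v \<bullet>c w)"
  unfolding cscalar_sum[OF smult_carrier_vec[THEN iffD2, OF assms(2), of a]] cscalar_sum[OF assms(2)]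
  using assms by (simp add: sum_distrib_left mult_ac)

text \<open>Zero rows make the matrix square without changing its kernel, and its determinant
  then vanishes. All dimension counts below are applications of this fact: fewer linear conditions than
  unknowns leave a nonzero solution.\<close>

lemma wide_matrix_kernel:
  fixes R :: "'a::field mat"
  assumes R: "R \<in> carrier_mat r c" and "r < c"
  shows "\<exists>v\<in>carrier_vec c. v \<noteq> 0\<^sub>v c \<and> R *\<^sub>v v = 0\<^sub>v r"
proof -
  define S where "S = mat c c (\<lambda>(i, j). if i < r then R $$ (i, j) else 0)"
  have S: "S \<in> carrier_mat c c" unfolding S_def by simp
  have "S = mat\<^sub>r c c (\<lambda>i. if i = r then 0\<^sub>v c else row S i)"
    unfolding S_def by (intro eq_matI) auto
  then have "det S = 0"
    using det_row_0[OF \<open>r < c\<close>, of "\<lambda>i. row S i"] S by auto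
  then obtain v where v: "v \<in> carrier_vec c" "v \<noteq> 0\<^sub>v c" "S *\<^sub>v v = 0\<^sub>v c"
    using det_0_iff_vec_prod_zero_field[OF S] by auto
  have "(R *\<^sub>v v) $ i = 0" if "i < r" for i
  proof -
    have "(R *\<^sub>v v) $ i = (S *\<^sub>v v) $ i"
      using that \<open>r < c\<close> by (simp add: mult_mat_vec_sum[OF R v(1)] mult_mat_vec_sum[OF S v(1)]) (simp add: S_def)
    then show ?thesis using v(3) that \<open>r < c\<close> by simp
  qed
  then show ?thesis using v R by (intro bexI[of _ v]) auto
qed

section \<open>Orthonormal families\<close>

text \<open>The index set is arbitrary because the left singular vectors are first known only for
  the nonzero singular values, and those sit at the end of the index range.\<close>

definition orthonormal_on :: "nat \<Rightarrow> nat set \<Rightarrow> (nat \<Rightarrow> complex vec) \<Rightarrow> bool" where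
  "orthonormal_on n S u \<longleftrightarrow> (\<forall>i\<in>S. u i \<in> carrier_vec n) \<and>
     (\<forall>i\<in>S. \<forall>j\<in>S. u i \<bullet>c u j = (if i = j then 1 else 0))"

lemma orthonormal_onD:
  assumes "orthonormal_on n S u"
  shows "i \<in> S \<Longrightarrow> u i \<in> carrier_vec n"
    and "i \<in> S \<Longrightarrow> j \<in> S \<Longrightarrow> u i \<bullet>c u j = (if i = j then 1 else 0)"
  using assms unfolding orthonormal_on_def by auto

lemma cscalar_self_nonzero:
  fixes v :: "complex vec"
  assumes v: "v \<in> carrier_vec n" and nz: "v \<noteq> 0\<^sub>v n"
  shows "\<exists>c>0. v \<bullet>c v = complex_of_real c"
proof -
  obtain i where i: "i < n" "v $ i \<noteq> 0" using v nz by (metis eq_vecI index_zero_vec carrier_vecD)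
  have "0 < (\<Sum>i<n. (cmod (v $ i))\<^sup>2)"
    using i by (intro sum_pos2[of _ i]) auto
  then show ?thesis unfolding cscalar_self[OF v] by blast
qed

lemma normalize_vec:
  fixes v :: "complex vec"
  assumes v: "v \<in> carrier_vec n" and nz: "v \<noteq> 0\<^sub>v n"
  shows "\<exists>a. (a \<cdot>\<^sub>v v) \<bullet>c (a \<cdot>\<^sub>v v) = 1"
proof -
  obtain c where c: "c > 0" "v \<bullet>c v = complex_of_real c" using cscalar_self_nonzero[OF assms] by blast
  define a where "a = complex_of_real (1 / sqrt c)"
  have av: "a \<cdot>\<^sub>v v \<in> carrier_vec n" using v by simp
  have "(a \<cdot>\<^sub>v v) \<bullet>c (a \<cdot>\<^sub>v v) = a * (cnj a * complex_of_real c)"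
    by (simp only: cscalar_smult_left[OF v av] cscalar_smult_right[OF v v] c)
  also have "\<dots> = complex_of_real ((1 / sqrt c) * (1 / sqrt c) * c)"
    unfolding a_def by (simp only: complex_cnj_complex_of_real of_real_mult mult.assoc)
  also have "(1 / sqrt c) * (1 / sqrt c) * c = 1" using c by (simp add: field_simps)
  finally show ?thesis by auto
qed

lemma orthonormal_extend_one:
  assumes o: "orthonormal_on n S u" and S: "finite S" "card S < n" and k: "k \<notin> S"
  shows "\<exists>w. orthonormal_on n (insert k S) (u(k := w))"
proof -
  obtain e where e: "bij_betw e {..<card S} S" using ex_bij_betw_nat_finite[OF S(1)] by (auto simp: lessThan_atLeast0)
  define R where "R = mat (card S) n (\<lambda>(i, r). cnj (u (e i) $ r))"
  have R: "R \<in> carrier_mat (card S) n" unfolding R_def by simp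
  obtain v where v: "v \<in> carrier_vec n" "v \<noteq> 0\<^sub>v n" "R *\<^sub>v v = 0\<^sub>v (card S)"
    using wide_matrix_kernel[OF R S(2)] by blast
  have vu: "v \<bullet>c u j = 0" if "j \<in> S" for j
  proof -
    have "j \<in> e ` {..<card S}" using bij_betw_imp_surj_on[OF e] that by simp
    then obtain i where i: "i < card S" "j = e i" by auto
    have "v \<bullet>c u j = (R *\<^sub>v v) $ i"
      unfolding cscalar_sum[OF orthonormal_onD(1)[OF o that]] mult_mat_vec_sum[OF R v(1) i(1)]
      using i by (simp add: R_def mult.commute)
    then show ?thesis using v(3) i by simp
  qed
  obtain a where a: "(a \<cdot>\<^sub>v v) \<bullet>c (a \<cdot>\<^sub>v v) = 1" using normalize_vec[OF v(1,2)] by blast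
  define w where "w = a \<cdot>\<^sub>v v"
  have w: "w \<in> carrier_vec n" using v unfolding w_def by simp
  have wu: "w \<bullet>c u j = 0" "u j \<bullet>c w = 0" if "j \<in> S" for j
  proof -
    note uj = orthonormal_onD(1)[OF o that]
    show *: "w \<bullet>c u j = 0" using vu[OF that] unfolding w_def cscalar_smult_left[OF v(1) uj] by simp
    show "u j \<bullet>c w = 0" unfolding cscalar_commute[OF w uj] * by simp
  qed
  have ww: "w \<bullet>c w = 1" using a unfolding w_def .
  have "orthonormal_on n (insert k S) (u(k := w))"
    unfolding orthonormal_on_def using w wu ww orthonormal_onD[OF o] k by auto
  then show ?thesis by blast
qed

lemma orthonormal_extend:
  assumes "orthonormal_on n S u" and "S \<subseteq> {..<n}"
  shows "\<exists>u'. orthonormal_on n {..<n} u' \<and> (\<forall>i\<in>S. u' i = u i)"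
  using assms
proof (induction "n - card S" arbitrary: S u)
  case 0
  then have "S = {..<n}" by (intro card_seteq) auto
  then show ?case using 0 by blast
next
  case (Suc d)
  have fin: "finite S" using Suc.prems(2) finite_subset by blast
  have lt: "card S < n" using Suc.hyps(2) by linarith
  then obtain k where k: "k \<in> {..<n}" "k \<notin> S"
    using Suc.prems(2) by (metis card_lessThan less_irrefl subsetI subset_antisym)
  obtain w where w: "orthonormal_on n (insert k S) (u(k := w))"
    using orthonormal_extend_one[OF Suc.prems(1) fin lt k(2)] by blast
  have "d = n - card (insert k S)" using Suc.hyps(2) k fin by simp
  from Suc.hyps(1)[OF this w] obtain u' where u': "orthonormal_on n {..<n} u'"
    "\<forall>i\<in>insert k S. u' i = (u(k := w)) i" using Suc.prems(2) k by auto
  then have "\<forall>i\<in>S. u' i = u i" using k by auto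
  then show ?case using u' by blast
qed

text \<open>Orthonormality says \<open>U\<^sup>* U = 1\<close> for the matrix \<open>U\<close> with columns \<open>u i\<close>; the claim is
  the entrywise form of \<open>U U\<^sup>* = 1\<close>, which follows because a left inverse of a square matrix is also a
  right inverse.\<close>

lemma orthonormal_completeness:
  assumes o: "orthonormal_on n {..<n} u" and rs: "r < n" "s < n"
  shows "(\<Sum>i<n. u i $ r * cnj (u i $ s)) = (if r = s then 1 else 0)"
proof -
  define V where "V = mat n n (\<lambda>(r, i). u i $ r)"
  define W where "W = mat n n (\<lambda>(i, r). cnj (u i $ r))"
  have V: "V \<in> carrier_mat n n" and W: "W \<in> carrier_mat n n" unfolding V_def W_def by auto
  have "W * V = 1\<^sub>m n"
  proof (rule eq_matI)
    fix i j assume "i < dim_row (1\<^sub>m n :: complex mat)" "j < dim_col (1\<^sub>m n :: complex mat)"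
    then have ij: "i < n" "j < n" by auto
    have "(W * V) $$ (i, j) = u j \<bullet>c u i"
      unfolding cscalar_sum[OF orthonormal_onD(1)[OF o, of i, unfolded lessThan_iff, OF ij(1)]]
      using ij by (simp add: V_def W_def scalar_prod_def lessThan_atLeast0 mult.commute)
    then show "(W * V) $$ (i, j) = 1\<^sub>m n $$ (i, j)"
      using ij orthonormal_onD(2)[OF o, of j i] by simp
  qed (use V W in auto)
  then have "V * W = 1\<^sub>m n" using mat_mult_left_right_inverse[OF W V] by simp
  moreover have "(V * W) $$ (r, s) = (\<Sum>i<n. u i $ r * cnj (u i $ s))"
    using rs by (simp add: V_def W_def scalar_prod_def lessThan_atLeast0)
  ultimately show ?thesis using rs by simp
qed

lemma orthonormal_expansion:
  assumes o: "orthonormal_on n {..<n} u" and v: "v \<in> carrier_vec n" and r: "r < n"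
  shows "v $ r = (\<Sum>i<n. (v \<bullet>c u i) * u i $ r)"
proof -
  have "(\<Sum>i<n. (v \<bullet>c u i) * u i $ r) = (\<Sum>i<n. \<Sum>s<n. v $ s * cnj (u i $ s) * u i $ r)"
    by (intro sum.cong refl) (simp add: cscalar_sum[OF orthonormal_onD(1)[OF o]] sum_distrib_right)
  also have "\<dots> = (\<Sum>s<n. v $ s * (\<Sum>i<n. u i $ r * cnj (u i $ s)))"
    by (subst sum.swap) (simp add: sum_distrib_left mult_ac)
  also have "\<dots> = v $ r"
    using r by (simp add: orthonormal_completeness[OF o r] if_distrib[of "\<lambda>x. _ * x"] cong: if_cong)
  finally show ?thesis by simp
qed

lemma orthonormal_parseval:
  assumes o: "orthonormal_on n {..<n} u" and v: "v \<in> carrier_vec n" and w: "w \<in> carrier_vec n"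
  shows "v \<bullet>c w = (\<Sum>i<n. (v \<bullet>c u i) * cnj (w \<bullet>c u i))"
proof -
  have "v \<bullet>c w = (\<Sum>r<n. \<Sum>i<n. (v \<bullet>c u i) * u i $ r * cnj (w $ r))"
    unfolding cscalar_sum[OF w]
    by (intro sum.cong refl) (simp add: orthonormal_expansion[OF o v] sum_distrib_right)
  also have "\<dots> = (\<Sum>i<n. (v \<bullet>c u i) * (u i \<bullet>c w))"
    by (subst sum.swap) (simp add: cscalar_sum[OF w] sum_distrib_left mult_ac)
  also have "\<dots> = (\<Sum>i<n. (v \<bullet>c u i) * cnj (w \<bullet>c u i))"
    by (intro sum.cong refl) (metis cscalar_commute[OF w orthonormal_onD(1)[OF o]])
  finally show ?thesis .
qed

lemma orthonormal_vec_eqI: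
  assumes o: "orthonormal_on n {..<n} u" and v: "v \<in> carrier_vec n" and w: "w \<in> carrier_vec n"
    and eq: "\<And>i. i < n \<Longrightarrow> v \<bullet>c u i = w \<bullet>c u i"
  shows "v = w"
proof (rule eq_vecI)
  fix r assume "r < dim_vec w"
  then have r: "r < n" using w by simp
  show "v $ r = w $ r"
    unfolding orthonormal_expansion[OF o v r] orthonormal_expansion[OF o w r] using eq by simp
qed (use v w in simp)

lemma mult_mat_vec_expansion:
  fixes X :: "complex mat"
  assumes X: "X \<in> carrier_mat m n" and o: "orthonormal_on n {..<n} w" and x: "x \<in> carrier_vec n" and r: "r < m"
  shows "(X *\<^sub>v x) $ r = (\<Sum>j<n. (x \<bullet>c w j) * (X *\<^sub>v w j) $ r)"
proof -
  have "(X *\<^sub>v x) $ r = (\<Sum>c<n. \<Sum>j<n. X $$ (r, c) * ((x \<bullet>c w j) * w j $ c))"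
    unfolding mult_mat_vec_sum[OF X x r]
    by (intro sum.cong refl) (simp add: orthonormal_expansion[OF o x] sum_distrib_left)
  also have "\<dots> = (\<Sum>j<n. (x \<bullet>c w j) * (\<Sum>c<n. X $$ (r, c) * w j $ c))"
    by (subst sum.swap) (simp add: sum_distrib_left mult_ac)
  also have "\<dots> = (\<Sum>j<n. (x \<bullet>c w j) * (X *\<^sub>v w j) $ r)"
    by (intro sum.cong refl) (use mult_mat_vec_sum[OF X _ r] orthonormal_onD(1)[OF o] in auto)
  finally show ?thesis .
qed

section \<open>The spectral theorem\<close>

lemma sorting_permutation:
  fixes l :: "nat \<Rightarrow> real"
  shows "\<exists>p. p permutes {..<n} \<and> (\<forall>i j. i \<le> j \<longrightarrow> j < n \<longrightarrow> l (p i) \<le> l (p j))"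
proof -
  let ?xs = "map l [0..<n]"
  have "mset (sort ?xs) = mset ?xs" by simp
  then obtain p where p: "p permutes {..<length ?xs}" "permute_list p ?xs = sort ?xs"
    by (rule mset_eq_permutation)
  have p': "p permutes {..<n}" using p(1) by simp
  have nth: "sort ?xs ! i = l (p i)" if "i < n" for i
  proof -
    have "p i < n" using permutes_in_image[OF p', of i] that by simp
    then show ?thesis unfolding p(2)[symmetric] permute_list_def using that by simp
  qed
  have "l (p i) \<le> l (p j)" if "i \<le> j" "j < n" for i j
    using sorted_nth_mono[OF sorted_sort, of i j ?xs] nth[of i] nth[of j] that by simp
  then show ?thesis using p' by blast
qed

lemma orthonormal_eigenbasis_iff:
  assumes "X \<in> carrier_mat n n"
  shows "orthonormal_eigenbasis X l u \<longleftrightarrow>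
    orthonormal_on n {..<n} u \<and> (\<forall>i<n. X *\<^sub>v u i = complex_of_real (l i) \<cdot>\<^sub>v u i)"
  using assms unfolding orthonormal_eigenbasis_def orthonormal_on_def by auto

lemma complex_matrix_has_eigenvector:
  fixes B :: "complex mat"
  assumes B: "B \<in> carrier_mat d d" and d: "d > 0"
  shows "\<exists>c\<in>carrier_vec d. \<exists>r. c \<noteq> 0\<^sub>v d \<and> B *\<^sub>v c = r \<cdot>\<^sub>v c"
proof -
  have "degree (char_poly B) = d" using degree_monic_char_poly[OF B] by simp
  then have "\<not> constant (poly (char_poly B))" using d by (simp add: constant_degree)
  then obtain r where "poly (char_poly B) r = 0" using fundamental_theorem_of_algebra by blast
  then have "eigenvalue B r" using eigenvalue_root_char_poly[OF B] by simp
  then show ?thesis using B unfolding eigenvalue_def eigenvector_def by auto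
qed

lemma hermitian_eigenvalue_real:
  fixes X :: "complex mat"
  assumes X: "X \<in> carrier_mat n n" "mat_adjoint X = X"
    and w: "w \<in> carrier_vec n" "w \<noteq> 0\<^sub>v n" "X *\<^sub>v w = r \<cdot>\<^sub>v w"
  shows "r = complex_of_real (Re r)"
proof -
  obtain c where c: "c > 0" "w \<bullet>c w = complex_of_real c" using cscalar_self_nonzero[OF w(1,2)] by blast
  have "r * (w \<bullet>c w) = cnj r * (w \<bullet>c w)"
    using hermitian_cscalar[OF X w(1) w(1)]
    unfolding w(3) cscalar_smult_left[OF w(1) w(1)] cscalar_smult_right[OF w(1) w(1)] .
  then have "cnj r = r" using c by simp
  then show ?thesis by (simp add: complex_eq_iff)
qed

text \<open>The orthogonal complement of the given eigenvectors is invariant under \<open>X\<close>. In an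
  orthonormal basis \<open>z m, \<dots>, z (n - 1)\<close> of it, \<open>X\<close> acts by a square matrix \<open>B\<close>; an eigenvector of
  \<open>B\<close> holds the coordinates of the eigenvector that is wanted.\<close>

lemma hermitian_eigenvector_in_complement:
  fixes X :: "complex mat"
  assumes X: "X \<in> carrier_mat n n" "mat_adjoint X = X" and m: "m < n"
    and o: "orthonormal_on n {..<m} u"
    and eig: "\<And>i. i < m \<Longrightarrow> X *\<^sub>v u i = complex_of_real (l i) \<cdot>\<^sub>v u i"
  shows "\<exists>a w. w \<in> carrier_vec n \<and> w \<noteq> 0\<^sub>v n \<and> X *\<^sub>v w = complex_of_real a \<cdot>\<^sub>v w \<and> (\<forall>i<m. w \<bullet>c u i = 0)"
proof -
  obtain z where z: "orthonormal_on n {..<n} z" and zu: "\<And>i. i < m \<Longrightarrow> z i = u i"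
    using orthonormal_extend[OF o] m by auto
  have zc: "z i \<in> carrier_vec n" if "i < n" for i using orthonormal_onD(1)[OF z] that by simp
  have zz: "z i \<bullet>c z j = (if i = j then 1 else 0)" if "i < n" "j < n" for i j
    using orthonormal_onD(2)[OF z] that by simp
  define d where "d = n - m"
  define B where "B = mat d d (\<lambda>(i, j). (X *\<^sub>v z (m + j)) \<bullet>c z (m + i))"
  have B: "B \<in> carrier_mat d d" unfolding B_def by simp
  obtain c r where c: "c \<in> carrier_vec d" "c \<noteq> 0\<^sub>v d" "B *\<^sub>v c = r \<cdot>\<^sub>v c"
    using complex_matrix_has_eigenvector[OF B] m unfolding d_def by auto
  define w where "w = vec n (\<lambda>s. \<Sum>j<d. c $ j * z (m + j) $ s)"
  have w: "w \<in> carrier_vec n" unfolding w_def by simp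
  have wy: "w \<bullet>c y = (\<Sum>j<d. c $ j * (z (m + j) \<bullet>c y))" if y: "y \<in> carrier_vec n" for y
    unfolding cscalar_sum[OF y] sum_distrib_left
    by (subst sum.swap) (simp add: w_def sum_distrib_right mult.assoc)
  have wz: "w \<bullet>c z i = (if i < m then 0 else c $ (i - m))" if i: "i < n" for i
  proof -
    have "w \<bullet>c z i = (\<Sum>j<d. if j = i - m \<and> m \<le> i then c $ j else 0)"
      unfolding wy[OF zc[OF i]] by (intro sum.cong refl) (use i in \<open>auto simp: zz d_def\<close>)
    also have "\<dots> = (if i < m then 0 else c $ (i - m))"
      using i by (auto simp: d_def)
    finally show ?thesis .
  qed
  have Xw: "X *\<^sub>v w \<in> carrier_vec n" using X w by simp
  have "(X *\<^sub>v w) \<bullet>c z i = (r \<cdot>\<^sub>v w) \<bullet>c z i" if i: "i < n" for i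
  proof (cases "i < m")
    case True
    have "(X *\<^sub>v w) \<bullet>c z i = w \<bullet>c (complex_of_real (l i) \<cdot>\<^sub>v z i)"
      using hermitian_cscalar[OF X w zc[OF i]] eig[OF True] zu[OF True] by simp
    then show ?thesis
      unfolding cscalar_smult_right[OF w zc[OF i]] cscalar_smult_left[OF w zc[OF i]] wz[OF i] using True by simp
  next
    case False
    have Xzi: "X *\<^sub>v z i \<in> carrier_vec n" using X zc[OF i] by simp
    have "(X *\<^sub>v w) \<bullet>c z i = (\<Sum>j<d. c $ j * ((X *\<^sub>v z (m + j)) \<bullet>c z i))"
      unfolding hermitian_cscalar[OF X w zc[OF i]] wy[OF Xzi]
      by (intro sum.cong refl) (simp add: hermitian_cscalar[OF X zc zc[OF i]] d_def)
    also have "\<dots> = (B *\<^sub>v c) $ (i - m)"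
      using mult_mat_vec_sum[OF B c(1), of "i - m"] i False
      by (simp add: B_def d_def mult.commute)
    also have "\<dots> = r * (w \<bullet>c z i)" using c wz[OF i] i False by (simp add: d_def)
    finally show ?thesis unfolding cscalar_smult_left[OF w zc[OF i]] .
  qed
  then have eq: "X *\<^sub>v w = r \<cdot>\<^sub>v w"
    by (intro orthonormal_vec_eqI[OF z Xw]) (use w in auto)
  have nz: "w \<noteq> 0\<^sub>v n"
  proof
    assume "w = 0\<^sub>v n"
    have "c = 0\<^sub>v d"
    proof (rule eq_vecI)
      fix i assume "i < dim_vec (0\<^sub>v d :: complex vec)"
      then have i: "m + i < n" "i < d" by (auto simp: d_def)
      have "c $ i = w \<bullet>c z (m + i)" using wz[OF i(1)] by simp
      also have "\<dots> = 0" unfolding \<open>w = 0\<^sub>v n\<close> cscalar_sum[OF zc[OF i(1)]] by simp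
      finally show "c $ i = 0\<^sub>v d $ i" using i by simp
    qed (use c in simp)
    then show False using c by simp
  qed
  have "X *\<^sub>v w = complex_of_real (Re r) \<cdot>\<^sub>v w"
    using eq hermitian_eigenvalue_real[OF X w nz eq] by simp
  moreover have "\<forall>i<m. w \<bullet>c u i = 0" using wz zu m by (metis less_trans)
  ultimately show ?thesis using w nz by blast
qed

text \<open>The spectral theorem in a form that lets part of the eigenbasis be prescribed. This
  freedom is what makes an eigenbasis adapted to the kernel of \<open>M\<close> possible.\<close>

lemma spectral_extend:
  fixes X :: "complex mat"
  assumes X: "X \<in> carrier_mat n n" "mat_adjoint X = X" and "m \<le> n"
    and "orthonormal_on n {..<m} u"
    and "\<And>i. i < m \<Longrightarrow> X *\<^sub>v u i = complex_of_real (l i) \<cdot>\<^sub>v u i"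
  shows "\<exists>l' u'. orthonormal_eigenbasis X l' u' \<and> (\<forall>i<m. l' i = l i \<and> u' i = u i)"
  using assms(3-)
proof (induction "n - m" arbitrary: m l u)
  case 0
  then show ?case unfolding orthonormal_eigenbasis_iff[OF X(1)] by (intro exI[of _ l] exI[of _ u]) auto
next
  case (Suc d)
  have m: "m < n" using Suc.hyps(2) by simp
  obtain a w where w: "w \<in> carrier_vec n" "w \<noteq> 0\<^sub>v n" "X *\<^sub>v w = complex_of_real a \<cdot>\<^sub>v w"
    and wu: "\<And>i. i < m \<Longrightarrow> w \<bullet>c u i = 0"
    using hermitian_eigenvector_in_complement[OF X m Suc.prems(2,3)] by blast
  obtain b where b: "(b \<cdot>\<^sub>v w) \<bullet>c (b \<cdot>\<^sub>v w) = 1" using normalize_vec[OF w(1,2)] by blast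
  define v where "v = b \<cdot>\<^sub>v w"
  have v: "v \<in> carrier_vec n" "v \<bullet>c v = 1" using w b unfolding v_def by auto
  have uc: "u i \<in> carrier_vec n" if "i < m" for i using orthonormal_onD(1)[OF Suc.prems(2)] that by simp
  have vu: "v \<bullet>c u i = 0" "u i \<bullet>c v = 0" if "i < m" for i
  proof -
    show *: "v \<bullet>c u i = 0" unfolding v_def cscalar_smult_left[OF w(1) uc[OF that]] wu[OF that] by simp
    show "u i \<bullet>c v = 0" unfolding cscalar_commute[OF v(1) uc[OF that]] * by simp
  qed
  have Xv: "X *\<^sub>v v = complex_of_real a \<cdot>\<^sub>v v"
    unfolding v_def mult_mat_vec[OF X(1) w(1)] w(3) by (simp add: smult_smult_assoc mult.commute)
  have o: "orthonormal_on n {..<Suc m} (u(m := v))"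
    using v vu orthonormal_onD[OF Suc.prems(2)] unfolding orthonormal_on_def by (auto simp: less_Suc_eq)
  have "d = n - Suc m" "Suc m \<le> n" using Suc.hyps(2) by auto
  moreover have "X *\<^sub>v (u(m := v)) i = complex_of_real ((l(m := a)) i) \<cdot>\<^sub>v (u(m := v)) i" if "i < Suc m" for i
    using that Xv Suc.prems(3) by (cases "i = m") auto
  ultimately obtain l' u' where
    "orthonormal_eigenbasis X l' u'" "\<forall>i<Suc m. l' i = (l(m := a)) i \<and> u' i = (u(m := v)) i"
    using Suc.hyps(1)[of "Suc m" "u(m := v)" "l(m := a)"] o by blast
  then show ?case by (intro exI[of _ l'] exI[of _ u']) auto
qed

lemma orthonormal_eigenbasis_permute:
  assumes X: "X \<in> carrier_mat n n" and e: "orthonormal_eigenbasis X l u" and p: "p permutes {..<n}"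
  shows "orthonormal_eigenbasis X (l \<circ> p) (u \<circ> p)"
proof -
  have "p i < n" if "i < n" for i using permutes_in_image[OF p, of i] that by simp
  moreover have "p i = p j \<longleftrightarrow> i = j" for i j using permutes_inj[OF p] by (simp add: inj_eq)
  ultimately show ?thesis
    using e unfolding orthonormal_eigenbasis_iff[OF X] orthonormal_on_def by simp
qed

lemma hermitian_eigenbasis_exists:
  fixes X :: "complex mat"
  assumes X: "X \<in> carrier_mat n n" "mat_adjoint X = X"
  shows "\<exists>l u. orthonormal_eigenbasis X l u \<and> (\<forall>i j. i \<le> j \<longrightarrow> j < n \<longrightarrow> l i \<le> l j)"
proof -
  obtain l u where "orthonormal_eigenbasis X l u"
    using spectral_extend[OF X, of 0] by (auto simp: orthonormal_on_def)
  then have e: "orthonormal_eigenbasis X l u" .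
  obtain p where p: "p permutes {..<n}" "\<forall>i j. i \<le> j \<longrightarrow> j < n \<longrightarrow> l (p i) \<le> l (p j)"
    using sorting_permutation[of n l] by blast
  show ?thesis
    using orthonormal_eigenbasis_permute[OF X(1) e p(1)] p(2)
    by (intro exI[of _ "l \<circ> p"] exI[of _ "u \<circ> p"]) simp
qed

section \<open>Eigenvalues of a function of a Hermitian matrix\<close>

text \<open>The matrix with eigenvalues \<open>g i\<close> and eigenvectors \<open>u i\<close>. It has the shape of the matrix
  selected in \<open>mat_fun\<close>, with \<open>g = f \<circ> l\<close>; the matrix itself is the case \<open>g = l\<close>.\<close>

definition spectral_mat :: "nat \<Rightarrow> (nat \<Rightarrow> real) \<Rightarrow> (nat \<Rightarrow> complex vec) \<Rightarrow> complex mat" where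
  "spectral_mat n g u = mat n n (\<lambda>(r, c). \<Sum>i<n. complex_of_real (g i) * (u i $ r * cnj (u i $ c)))"

lemma eigenbasis_spectral_mat:
  assumes X: "X \<in> carrier_mat n n" and e: "orthonormal_eigenbasis X l u"
  shows "X = spectral_mat n l u"
proof (rule eq_matI)
  have o: "orthonormal_on n {..<n} u" and eig: "\<And>i. i < n \<Longrightarrow> X *\<^sub>v u i = complex_of_real (l i) \<cdot>\<^sub>v u i"
    using e unfolding orthonormal_eigenbasis_iff[OF X] by auto
  fix r s assume "r < dim_row (spectral_mat n l u)" "s < dim_col (spectral_mat n l u)"
  then have rs: "r < n" "s < n" by (auto simp: spectral_mat_def)
  have "X $$ (r, s) = (\<Sum>t<n. X $$ (r, t) * (\<Sum>i<n. u i $ t * cnj (u i $ s)))"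
    using rs by (simp add: orthonormal_completeness[OF o _ rs(2)] if_distrib[of "\<lambda>x. _ * x"] cong: if_cong)
  also have "\<dots> = (\<Sum>i<n. (X *\<^sub>v u i) $ r * cnj (u i $ s))"
    using orthonormal_onD(1)[OF o] rs
    by (simp add: sum_distrib_left sum_distrib_right mult.assoc mult_mat_vec_sum[OF X _ rs(1)])
       (rule sum.swap)
  also have "\<dots> = spectral_mat n l u $$ (r, s)"
  proof -
    have "(X *\<^sub>v u i) $ r = complex_of_real (l i) * u i $ r" if "i < n" for i
      using orthonormal_onD(1)[OF o, of i] rs that by (simp add: eig)
    then show ?thesis using rs by (simp add: spectral_mat_def mult.assoc)
  qed
  finally show "X $$ (r, s) = spectral_mat n l u $$ (r, s)" .
qed (use X in \<open>auto simp: spectral_mat_def\<close>)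

text \<open>The matrix of the vectors \<open>u i\<close> conjugates it to a diagonal matrix.\<close>

lemma char_poly_spectral_mat:
  assumes o: "orthonormal_on n {..<n} u"
  shows "char_poly (spectral_mat n g u) = (\<Prod>a\<leftarrow>map (complex_of_real \<circ> g) [0..<n]. [:- a, 1:])"
proof -
  define V where "V = mat n n (\<lambda>(r, i). u i $ r)"
  define W where "W = mat n n (\<lambda>(i, r). cnj (u i $ r))"
  define D where "D = mat_diag n (\<lambda>i. complex_of_real (g i))"
  have V: "V \<in> carrier_mat n n" and W: "W \<in> carrier_mat n n" and D: "D \<in> carrier_mat n n"
    unfolding V_def W_def D_def by auto
  have VW: "V * W = 1\<^sub>m n"
  proof (rule eq_matI)
    fix r s assume "r < dim_row (1\<^sub>m n :: complex mat)" "s < dim_col (1\<^sub>m n :: complex mat)"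
    then have rs: "r < n" "s < n" by auto
    then show "(V * W) $$ (r, s) = 1\<^sub>m n $$ (r, s)"
      using orthonormal_completeness[OF o rs]
      by (simp add: V_def W_def scalar_prod_def lessThan_atLeast0)
  qed (use V W in auto)
  have WV: "W * V = 1\<^sub>m n" using mat_mult_left_right_inverse[OF V W VW] .
  have "spectral_mat n g u = V * D * W"
    unfolding D_def mat_diag_mult_right[OF V]
    by (rule eq_matI) (auto simp: spectral_mat_def V_def W_def scalar_prod_def lessThan_atLeast0 mult_ac)
  then have "similar_mat (spectral_mat n g u) D"
    using V W D VW WV by (intro similar_matI[of _ _ V W n]) (auto simp: spectral_mat_def)
  then have "char_poly (spectral_mat n g u) = char_poly D" by (rule char_poly_similar)
  also have "\<dots> = (\<Prod>a\<leftarrow>diag_mat D. [:- a, 1:])"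
    by (rule char_poly_upper_triangular[OF D]) (auto simp: upper_triangular_def D_def mat_diag_def)
  also have "diag_mat D = map (complex_of_real \<circ> g) [0..<n]"
    by (auto simp: diag_mat_def D_def mat_diag_def intro!: nth_equalityI)
  finally show ?thesis .
qed

lemma proots_char_poly_spectral_mat:
  assumes o: "orthonormal_on n {..<n} u"
  shows "image_mset Re (proots (char_poly (spectral_mat n g u))) = mset (map g [0..<n])"
proof -
  have proots_linear: "proots (\<Prod>a\<leftarrow>as. [:- a, 1:]) = mset as" for as :: "complex list"
  proof (induction as)
    case (Cons a as)
    have "(\<Prod>a\<leftarrow>as. [:- a, 1:]) \<noteq> (0 :: complex poly)" by (auto simp: prod_list_zero_iff)
    then show ?case using Cons by (simp add: proots_mult del: mult_pCons_left)
  qed simp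
  show ?thesis unfolding char_poly_spectral_mat[OF o] proots_linear
    by (simp add: multiset.map_comp comp_def)
qed

lemma mat_trace_spectral_mat:
  assumes o: "orthonormal_on n {..<n} u"
  shows "mat_trace (spectral_mat n g u) = complex_of_real (\<Sum>i<n. g i)"
proof -
  have "mat_trace (spectral_mat n g u) = (\<Sum>r<n. \<Sum>i<n. complex_of_real (g i) * (u i $ r * cnj (u i $ r)))"
    unfolding mat_trace_def by (simp add: spectral_mat_def)
  also have "\<dots> = (\<Sum>i<n. complex_of_real (g i) * (u i \<bullet>c u i))"
    by (subst sum.swap) (simp add: cscalar_sum[OF orthonormal_onD(1)[OF o]] sum_distrib_left)
  also have "\<dots> = complex_of_real (\<Sum>i<n. g i)" using orthonormal_onD(2)[OF o] by simp
  finally show ?thesis .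
qed

lemma eigenvalues_eq_proots:
  assumes X: "X \<in> carrier_mat n n" and e: "orthonormal_eigenbasis X l u"
  shows "mset (map l [0..<n]) = image_mset Re (proots (char_poly X))"
  using proots_char_poly_spectral_mat[of n u l] e
  unfolding eigenbasis_spectral_mat[OF X e, symmetric] orthonormal_eigenbasis_iff[OF X] by simp

lemma mat_fun_eq_spectral_mat:
  fixes X :: "complex mat"
  assumes X: "X \<in> carrier_mat n n" "mat_adjoint X = X"
  shows "\<exists>l u. orthonormal_eigenbasis X l u \<and> mat_fun f X = spectral_mat n (f \<circ> l) u"
proof -
  have dim: "dim_row X = n" using X by simp
  obtain l u where e: "orthonormal_eigenbasis X l u" using hermitian_eigenbasis_exists[OF X] by blast
  have "\<exists>l u. orthonormal_eigenbasis X l u \<and> mat_fun f X =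
    mat n n (\<lambda>(r, c). \<Sum>i<n. complex_of_real (f (l i)) * (u i $ r * cnj (u i $ c)))"
    unfolding mat_fun_def dim by (rule someI_ex) (use e in blast)
  then show ?thesis unfolding spectral_mat_def comp_def .
qed

text \<open>The eigenbasis \<open>l'\<close>, \<open>u'\<close> selected inside \<open>mat_fun\<close> is unknown, but \<open>l'\<close> and \<open>l\<close> list the
  same roots of the characteristic polynomial of \<open>X\<close>. Hence any convenient eigenbasis of \<open>X\<close> can be
  used to evaluate traces and eigenvalues of \<open>f(X)\<close>.\<close>

lemma mat_fun_eigenvalues:
  fixes X :: "complex mat"
  assumes X: "X \<in> carrier_mat n n" "mat_adjoint X = X" and e: "orthonormal_eigenbasis X l u"
  shows "image_mset Re (proots (char_poly (mat_fun f X))) = mset (map (f \<circ> l) [0..<n])"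
    and "Re (mat_trace (mat_fun f X)) = (\<Sum>i<n. f (l i))"
proof -
  obtain l' u' where e': "orthonormal_eigenbasis X l' u'" and F: "mat_fun f X = spectral_mat n (f \<circ> l') u'"
    using mat_fun_eq_spectral_mat[OF X] by blast
  have o: "orthonormal_on n {..<n} u'" using e' unfolding orthonormal_eigenbasis_iff[OF X(1)] by simp
  have "mset (map l' [0..<n]) = mset (map l [0..<n])"
    unfolding eigenvalues_eq_proots[OF X(1) e] eigenvalues_eq_proots[OF X(1) e'] ..
  then have "image_mset f (mset (map l' [0..<n])) = image_mset f (mset (map l [0..<n]))" by simp
  then have m: "mset (map (f \<circ> l') [0..<n]) = mset (map (f \<circ> l) [0..<n])"
    by (simp add: multiset.map_comp comp_def)
  show "image_mset Re (proots (char_poly (mat_fun f X))) = mset (map (f \<circ> l) [0..<n])"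
    unfolding F proots_char_poly_spectral_mat[OF o] by (rule m)
  have "sum_list (map (f \<circ> l') [0..<n]) = sum_list (map (f \<circ> l) [0..<n])"
    using m by (metis sum_mset_sum_list)
  then show "Re (mat_trace (mat_fun f X)) = (\<Sum>i<n. f (l i))"
    unfolding F mat_trace_spectral_mat[OF o]
    by (simp add: interv_sum_list_conv_sum_set_nat lessThan_atLeast0)
qed

lemma eigval_up_mat_fun:
  fixes X :: "complex mat"
  assumes X: "X \<in> carrier_mat n n" "mat_adjoint X = X" and e: "orthonormal_eigenbasis X l u"
    and sorted: "\<And>i j. i \<le> j \<Longrightarrow> j < n \<Longrightarrow> f (l i) \<le> f (l j)" and i: "1 \<le> i" "i \<le> n"
  shows "eigval_up (mat_fun f X) i = f (l (i - 1))"
proof -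
  have srt: "sort (map (f \<circ> l) [0..<n]) = map (f \<circ> l) [0..<n]"
    by (rule sorted_sort_id) (auto simp: sorted_iff_nth_mono intro: sorted)
  show ?thesis
    unfolding eigval_up_def mat_fun_eigenvalues(1)[OF X e] sorted_list_of_multiset_mset srt
    using i by simp
qed

section \<open>Congruences and quadratic forms of positive semidefinite matrices\<close>

text \<open>Everything that is needed about \<open>H\<^sup>* A H\<close> is read off from this sesquilinear form, so
  its entries never appear.\<close>

lemma congruence_form:
  fixes A H :: "complex mat"
  assumes Ac: "A \<in> carrier_mat n n" and H: "H \<in> carrier_mat n n" and v: "v \<in> carrier_vec n" and w: "w \<in> carrier_vec n"
  shows "((mat_adjoint H * A * H) *\<^sub>v v) \<bullet>c w = (A *\<^sub>v (H *\<^sub>v v)) \<bullet>c (H *\<^sub>v w)"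
proof -
  note H' = mat_adjoint_carrier[OF H]
  have AH: "A * H \<in> carrier_mat n n" "mat_adjoint H * A \<in> carrier_mat n n" using Ac H H' by auto
  have Hv: "H *\<^sub>v v \<in> carrier_vec n" "A *\<^sub>v (H *\<^sub>v v) \<in> carrier_vec n" using H Ac v by auto
  have "(mat_adjoint H * A * H) *\<^sub>v v = mat_adjoint H *\<^sub>v (A *\<^sub>v (H *\<^sub>v v))"
    by (simp only: assoc_mult_mat_vec[OF AH(2) H v] assoc_mult_mat_vec[OF H' Ac Hv(1)])
  then show ?thesis by (simp only: cscalar_adjoint[OF H Hv(2) w])
qed

lemma hermitian_psd_congruence:
  assumes A: "A \<in> hermitian_psd n" and H: "H \<in> carrier_mat n n"
  shows "mat_adjoint H * A * H \<in> hermitian_psd n"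
proof -
  have Ac: "A \<in> carrier_mat n n" "mat_adjoint A = A"
    and pos: "\<And>v. v \<in> carrier_vec n \<Longrightarrow> 0 \<le> (A *\<^sub>v v) \<bullet>c v"
    using A unfolding hermitian_psd_def by auto
  note H' = mat_adjoint_carrier[OF H]
  have AH: "A * H \<in> carrier_mat n n" "mat_adjoint H * A \<in> carrier_mat n n" using Ac H H' by auto
  have "mat_adjoint (mat_adjoint H * A * H) = mat_adjoint H * A * H"
    unfolding mat_adjoint_mult[OF AH(2) H] mat_adjoint_mult[OF H' Ac(1)] mat_adjoint_adjoint[OF H] Ac(2)
    by (rule assoc_mult_mat[OF H' Ac(1) H, symmetric])
  moreover have "0 \<le> ((mat_adjoint H * A * H) *\<^sub>v v) \<bullet>c v" if v: "v \<in> carrier_vec n" for v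
    unfolding congruence_form[OF Ac(1) H v v] using H v by (intro pos) simp
  ultimately show ?thesis using AH H unfolding hermitian_psd_def by auto
qed

lemma congruence_product:
  fixes A G M :: "complex mat"
  assumes A: "A \<in> carrier_mat n n" and G: "G \<in> carrier_mat n n" and M: "M \<in> carrier_mat n n"
  shows "mat_adjoint M * mat_adjoint G * A * G * M = mat_adjoint (G * M) * A * (G * M)"
proof -
  have c: "mat_adjoint M * mat_adjoint G * A \<in> carrier_mat n n"
    using mat_adjoint_carrier[OF M] mat_adjoint_carrier[OF G] A by simp
  show ?thesis unfolding mat_adjoint_mult[OF G M] by (rule assoc_mult_mat[OF c G M])
qed

lemma one_mat_hermitian_psd: "(1\<^sub>m n :: complex mat) \<in> hermitian_psd n"
proof -
  have "mat_adjoint (1\<^sub>m n) = (1\<^sub>m n :: complex mat)"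
    by (rule eq_matI) (auto simp: mat_adjoint_index[of _ n n])
  moreover have "0 \<le> v \<bullet>c v" if v: "v \<in> carrier_vec n" for v :: "complex vec"
    unfolding cscalar_self[OF v] by (simp add: less_eq_complex_def sum_nonneg)
  ultimately show ?thesis unfolding hermitian_psd_def by simp
qed

text \<open>Parseval's identity, with \<open>(X v) \<bullet>c u i = l i (v \<bullet>c u i)\<close> by self-adjointness.\<close>

lemma quadratic_form_eigenbasis:
  fixes X :: "complex mat"
  assumes X: "X \<in> carrier_mat n n" "mat_adjoint X = X" and e: "orthonormal_eigenbasis X l u"
    and v: "v \<in> carrier_vec n"
  shows "(X *\<^sub>v v) \<bullet>c v = complex_of_real (\<Sum>i<n. l i * (cmod (v \<bullet>c u i))\<^sup>2)"
    and "v \<bullet>c v = complex_of_real (\<Sum>i<n. (cmod (v \<bullet>c u i))\<^sup>2)"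
proof -
  have o: "orthonormal_on n {..<n} u" and eig: "\<And>i. i < n \<Longrightarrow> X *\<^sub>v u i = complex_of_real (l i) \<cdot>\<^sub>v u i"
    using e unfolding orthonormal_eigenbasis_iff[OF X(1)] by auto
  have uc: "u i \<in> carrier_vec n" if "i < n" for i using orthonormal_onD(1)[OF o] that by simp
  have Xv: "X *\<^sub>v v \<in> carrier_vec n" using X v by simp
  have "(X *\<^sub>v v) \<bullet>c u i = complex_of_real (l i) * (v \<bullet>c u i)" if i: "i < n" for i
    unfolding hermitian_cscalar[OF X v uc[OF i]] eig[OF i] cscalar_smult_right[OF v uc[OF i]] by simp
  then show "(X *\<^sub>v v) \<bullet>c v = complex_of_real (\<Sum>i<n. l i * (cmod (v \<bullet>c u i))\<^sup>2)"
    unfolding orthonormal_parseval[OF o Xv v] of_real_sum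
    by (intro sum.cong refl) (simp only: lessThan_iff of_real_mult complex_norm_square mult.assoc)
  show "v \<bullet>c v = complex_of_real (\<Sum>i<n. (cmod (v \<bullet>c u i))\<^sup>2)"
    unfolding orthonormal_parseval[OF o v v] of_real_sum
    by (intro sum.cong refl) (simp only: complex_norm_square)
qed

lemma psd_eigenvalue_nonneg:
  assumes X: "X \<in> hermitian_psd n" and e: "orthonormal_eigenbasis X l u" and i: "i < n"
  shows "0 \<le> l i"
proof -
  have Xc: "X \<in> carrier_mat n n" and pos: "\<And>v. v \<in> carrier_vec n \<Longrightarrow> 0 \<le> (X *\<^sub>v v) \<bullet>c v"
    using X unfolding hermitian_psd_def by auto
  have u: "u i \<in> carrier_vec n" "u i \<bullet>c u i = 1" "X *\<^sub>v u i = complex_of_real (l i) \<cdot>\<^sub>v u i"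
    using e i unfolding orthonormal_eigenbasis_iff[OF Xc] orthonormal_on_def by auto
  show ?thesis
    using pos[OF u(1)] unfolding u(3) cscalar_smult_left[OF u(1) u(1)] u(2)
    by (simp add: less_eq_complex_def)
qed

section \<open>Idempotents of given rank\<close>

text \<open>A maximal independent set of columns of \<open>G\<close> has \<open>k\<close> elements, and \<open>G\<close> fixes each of its
  own columns.\<close>

lemma idempotent_range_basis:
  fixes G :: "complex mat"
  assumes G: "G \<in> carrier_mat n n" "G * G = G" and rk: "vec_space.rank n G = k"
  shows "\<exists>B\<in>carrier_mat n k. G * B = B \<and> (\<forall>z\<in>carrier_vec k. B *\<^sub>v z = 0\<^sub>v n \<longrightarrow> z = 0\<^sub>v k)"
proof -
  interpret vec_space "TYPE(complex)" n .
  obtain S where S: "maximal S (\<lambda>T. T \<subseteq> set (cols G) \<and> lin_indpt T)"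
    using maximal_exists_superset[of "set (cols G)" "\<lambda>T. T \<subseteq> set (cols G) \<and> lin_indpt T" "{}"]
    by (auto simp: lin_dep_def)
  have card: "card S = k" using rank_card_indpt[OF G(1) S] rk by simp
  have Ssub: "S \<subseteq> set (cols G)" and indpt: "lin_indpt S" using S unfolding maximal_def by auto
  obtain xs where xs: "set xs = S" "distinct xs"
    using finite_distinct_list finite_subset[OF Ssub] by auto
  have len: "length xs = k" using distinct_card[OF xs(2)] xs(1) card by simp
  have xsc: "set xs \<subseteq> carrier_vec n" using Ssub xs(1) cols_dim[of G] G(1) by auto
  define B where "B = mat_of_cols n xs"
  have B: "B \<in> carrier_mat n k" unfolding B_def len[symmetric] by simp
  have colsB: "cols B = xs" unfolding B_def by (rule cols_mat_of_cols[OF xsc])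
  have GB: "G * B = B"
  proof (rule mat_col_eqI)
    fix j assume j: "j < dim_col B"
    then have jk: "j < k" using B by simp
    have "col B j = xs ! j" using colsB j by (metis cols_nth)
    then have "col B j \<in> set (cols G)" using Ssub xs(1) jk len by (metis nth_mem subsetD)
    then obtain i where i: "i < n" "col B j = col G i"
      using G(1) by (metis carrier_matD(2) cols_length cols_nth in_set_conv_nth)
    have "col (G * B) j = G *\<^sub>v col B j" using col_mult2[OF G(1) B jk] .
    also have "\<dots> = col (G * G) i" unfolding i(2) using col_mult2[OF G(1) G(1) i(1)] by simp
    also have "\<dots> = col B j" using G(2) i(2) by simp
    finally show "col (G * B) j = col B j" .
  qed (use G B in auto)
  have "z = 0\<^sub>v k" if "z \<in> carrier_vec k" "B *\<^sub>v z = 0\<^sub>v n" for z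
    using lin_depI[OF B that(1) _ that(2)] colsB xs indpt by auto
  then show ?thesis using B GB by blast
qed

text \<open>Since \<open>(B C) B = B\<close>, the matrices \<open>B C\<close> and \<open>B\<close> have the same column space; the left
  inverse \<open>C\<close> makes the \<open>k\<close> columns of \<open>B\<close> independent.\<close>

lemma rank_of_split_factorization:
  fixes B C :: "complex mat"
  assumes B: "B \<in> carrier_mat n k" and C: "C \<in> carrier_mat k n" and CB: "C * B = 1\<^sub>m k"
  shows "vec_space.rank n (B * C) = k"
proof -
  interpret vec_space "TYPE(complex)" n .
  have BC: "B * C \<in> carrier_mat n n" using B C by simp
  have CBv: "C *\<^sub>v (B *\<^sub>v z) = z" if "z \<in> carrier_vec k" for z
    using assoc_mult_mat_vec[OF C B that] CB that by simp
  have "col_space (B * C) = col_space B"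
  proof (rule subset_antisym)
    show "col_space (B * C) \<subseteq> col_space B"
      using B C unfolding col_space_eq[OF B] col_space_eq[OF BC] by (auto intro!: bexI[of _ "C *\<^sub>v _"])
    show "col_space B \<subseteq> col_space (B * C)"
    proof
      fix y assume "y \<in> col_space B"
      then obtain x where x: "x \<in> carrier_vec k" "B *\<^sub>v x = y" "y \<in> carrier_vec n"
        using B unfolding col_space_eq[OF B] by auto
      have "(B * C) *\<^sub>v y = y"
        using assoc_mult_mat_vec[OF B C x(3)] CBv[OF x(1)] unfolding x(2)[symmetric] by simp
      then show "y \<in> col_space (B * C)"
        unfolding col_space_eq[OF BC] using B C x(3) by (intro CollectI conjI bexI[of _ y]) simp_all
    qed
  qed
  then have "rank (B * C) = rank B" unfolding rank_def col_space_def by simp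
  also have "rank B = k"
  proof (rule lin_indpt_full_rank[OF B])
    have inj: "i = j" if "i < k" "j < k" "col B i = col B j" for i j
    proof -
      have "unit_vec k i = (unit_vec k j :: complex vec)"
        using CB col_mult2[OF C B that(1)] col_mult2[OF C B that(2)] that by simp
      then show ?thesis using that by (metis index_unit_vec(1) zero_neq_one)
    qed
    show d: "distinct (cols B)" unfolding distinct_conv_nth using inj B by (auto simp: cols_nth) 
    show "lin_indpt (set (cols B))"
    proof
      assume "lin_dep (set (cols B))"
      then obtain v where v: "v \<in> carrier_vec k" "v \<noteq> 0\<^sub>v k" "B *\<^sub>v v = 0\<^sub>v n"
        using lin_depE[OF B _ d] by blast
      have "C *\<^sub>v 0\<^sub>v n = 0\<^sub>v k" using C by auto
      then show False using CBv[OF v(1)] v by simp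
    qed
  qed
  finally show ?thesis .
qed

section \<open>The lower bound: interlacing\<close>

lemma sum_lessThan_append:
  fixes g :: "nat \<Rightarrow> 'a::comm_monoid_add"
  shows "(\<Sum>b<n + k. g b) = (\<Sum>b<n. g b) + (\<Sum>i<k. g (n + i))"
  by (induction k) (simp_all add: add.assoc)

text \<open>Cauchy interlacing for two forms that agree on the vectors \<open>x\<close> with \<open>M x\<close> in the range
  of \<open>B\<close>. If such an \<open>x \<noteq> 0\<close> is orthogonal to \<open>u 0, \<dots>, u (j - 1)\<close> and to all \<open>v i\<close> with
  \<open>i > n - k + j\<close>, then its Rayleigh quotient is at least \<open>l j\<close> for \<open>X\<close> and at most
  \<open>m (n - k + j)\<close> for \<open>Y\<close>, and the two quotients are equal.

  To find \<open>x\<close> without computing the dimension of the preimage of a subspace under a possibly singular \<open>M\<close>,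
  the coordinates \<open>z\<close> of \<open>M x = B z\<close> are kept as additional unknowns. These are \<open>n\<close> equations and
  \<open>j + (k - 1 - j)\<close> orthogonality conditions on \<open>n + k\<close> unknowns. Injectivity of \<open>B\<close> excludes solutions
  with \<open>x = 0\<close>.\<close>

lemma eigenvalue_interlacing:
  fixes X Y :: "complex mat"
  assumes X: "X \<in> carrier_mat n n" "mat_adjoint X = X" and eX: "orthonormal_eigenbasis X l u"
    and sX: "\<And>i j. i \<le> j \<Longrightarrow> j < n \<Longrightarrow> l i \<le> l j"
    and Y: "Y \<in> carrier_mat n n" "mat_adjoint Y = Y" and eY: "orthonormal_eigenbasis Y m v"
    and sY: "\<And>i j. i \<le> j \<Longrightarrow> j < n \<Longrightarrow> m i \<le> m j"
    and M: "M \<in> carrier_mat n n" and B: "B \<in> carrier_mat n k"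
    and inj: "\<And>z. z \<in> carrier_vec k \<Longrightarrow> B *\<^sub>v z = 0\<^sub>v n \<Longrightarrow> z = 0\<^sub>v k"
    and agree: "\<And>x z. x \<in> carrier_vec n \<Longrightarrow> z \<in> carrier_vec k \<Longrightarrow> M *\<^sub>v x = B *\<^sub>v z \<Longrightarrow>
      (X *\<^sub>v x) \<bullet>c x = (Y *\<^sub>v x) \<bullet>c x"
    and j: "j < k" "k \<le> n"
  shows "l j \<le> m (n - k + j)"
proof -
  have uc: "u i \<in> carrier_vec n" and vc: "v i \<in> carrier_vec n" if "i < n" for i
    using eX eY that unfolding orthonormal_eigenbasis_iff[OF X(1)] orthonormal_eigenbasis_iff[OF Y(1)]
    by (auto simp: orthonormal_on_def)
  \<comment> \<open>Rows with index below \<open>n\<close> state \<open>M x = B z\<close>; of the \<open>k - 1\<close> others, the first \<open>j\<close> state orthogonality to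
    \<open>u 0, \<dots>, u (j - 1)\<close>. Row \<open>n + a\<close> with \<open>a \<ge> j\<close> uses \<open>v (n - k + 1 + a)\<close>, which runs from
    \<open>v (n - k + j + 1)\<close> to \<open>v (n - 1)\<close>.\<close>
  define R where "R = mat (n + (k - 1)) (n + k) (\<lambda>(a, b).
    if a < n then if b < n then M $$ (a, b) else - B $$ (a, b - n)
    else if n \<le> b then 0
    else if a - n < j then cnj (u (a - n) $ b) else cnj (v (n - k + 1 + (a - n)) $ b))"
  have R: "R \<in> carrier_mat (n + (k - 1)) (n + k)" unfolding R_def by simp
  have "n + (k - 1) < n + k" using j by simp
  then obtain y where y: "y \<in> carrier_vec (n + k)" "y \<noteq> 0\<^sub>v (n + k)" "R *\<^sub>v y = 0\<^sub>v (n + (k - 1))"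
    using wide_matrix_kernel[OF R] by blast
  define x where "x = vec n (\<lambda>i. y $ i)"
  define z where "z = vec k (\<lambda>i. y $ (n + i))"
  have x: "x \<in> carrier_vec n" and z: "z \<in> carrier_vec k" unfolding x_def z_def by auto
  have row: "(\<Sum>b<n. R $$ (a, b) * x $ b) + (\<Sum>i<k. R $$ (a, n + i) * z $ i) = 0" if "a < n + (k - 1)" for a
  proof -
    have "(R *\<^sub>v y) $ a = (\<Sum>b<n. R $$ (a, b) * y $ b) + (\<Sum>i<k. R $$ (a, n + i) * y $ (n + i))"
      unfolding mult_mat_vec_sum[OF R y(1) that] sum_lessThan_append ..
    then show ?thesis using y(3) that by (simp add: x_def z_def)
  qed
  have MB: "M *\<^sub>v x = B *\<^sub>v z"
  proof (rule eq_vecI)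
    fix a assume "a < dim_vec (B *\<^sub>v z)"
    then have a: "a < n" using B by simp
    have "(M *\<^sub>v x) $ a - (B *\<^sub>v z) $ a = 0"
      using row[of a] a unfolding mult_mat_vec_sum[OF M x a] mult_mat_vec_sum[OF B z a]
      by (simp add: R_def sum_negf)
    then show "(M *\<^sub>v x) $ a = (B *\<^sub>v z) $ a" by simp
  qed (use M B in simp)
  have xu: "x \<bullet>c u i = 0" if "i < j" for i
  proof -
    have "i < n" using that j by simp
    then show ?thesis
      using row[of "n + i"] that j unfolding cscalar_sum[OF uc[OF \<open>i < n\<close>]] by (simp add: R_def mult.commute)
  qed
  have xv: "x \<bullet>c v i = 0" if "n - k + j < i" "i < n" for i
  proof -
    define a where "a = i - (n - k + 1)"
    have a: "n + a < n + (k - 1)" "\<not> a < j" "n - k + 1 + a = i" using that j unfolding a_def by auto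
    show ?thesis
      using row[OF a(1)] a unfolding cscalar_sum[OF vc[OF that(2)]] by (simp add: R_def mult.commute)
  qed
  have "x \<noteq> 0\<^sub>v n"
  proof
    assume "x = 0\<^sub>v n"
    moreover have "M *\<^sub>v 0\<^sub>v n = 0\<^sub>v n" using M by auto
    ultimately have "B *\<^sub>v z = 0\<^sub>v n" using MB by simp
    then have "z = 0\<^sub>v k" using inj z by simp
    have "y = 0\<^sub>v (n + k)"
    proof (rule eq_vecI)
      fix b assume "b < dim_vec (0\<^sub>v (n + k) :: complex vec)"
      then have b: "b < n + k" by simp
      show "y $ b = 0\<^sub>v (n + k) $ b"
      proof (cases "b < n")
        case True
        then have "y $ b = x $ b" unfolding x_def by simp
        then show ?thesis using \<open>x = 0\<^sub>v n\<close> True by simp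
      next
        case False
        then have "y $ b = z $ (b - n)" using b False unfolding z_def by simp
        then show ?thesis using \<open>z = 0\<^sub>v k\<close> False b by simp
      qed
    qed (use y in simp)
    then show False using y by simp
  qed
  then obtain c where c: "c > 0" "x \<bullet>c x = complex_of_real c" using cscalar_self_nonzero[OF x] by blast
  have cu: "c = (\<Sum>i<n. (cmod (x \<bullet>c u i))\<^sup>2)" and cv: "c = (\<Sum>i<n. (cmod (x \<bullet>c v i))\<^sup>2)"
    using quadratic_form_eigenbasis(2)[OF X eX x] quadratic_form_eigenbasis(2)[OF Y eY x] c(2)
    by (metis of_real_eq_iff)+
  have "l j * c \<le> (\<Sum>i<n. l i * (cmod (x \<bullet>c u i))\<^sup>2)"
    unfolding cu sum_distrib_left
  proof (rule sum_mono)
    fix i assume "i \<in> {..<n}"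
    then show "l j * (cmod (x \<bullet>c u i))\<^sup>2 \<le> l i * (cmod (x \<bullet>c u i))\<^sup>2"
      using xu[of i] sX[of j i] by (cases "i < j") (auto intro!: mult_right_mono)
  qed
  also have "\<dots> = (\<Sum>i<n. m i * (cmod (x \<bullet>c v i))\<^sup>2)"
    using agree[OF x z MB]
    unfolding quadratic_form_eigenbasis(1)[OF X eX x] quadratic_form_eigenbasis(1)[OF Y eY x] of_real_eq_iff .
  also have "\<dots> \<le> m (n - k + j) * c"
    unfolding cv sum_distrib_left
  proof (rule sum_mono)
    fix i assume "i \<in> {..<n}"
    then show "m i * (cmod (x \<bullet>c v i))\<^sup>2 \<le> m (n - k + j) * (cmod (x \<bullet>c v i))\<^sup>2"
      using xv[of i] sY[of i "n - k + j"] j by (cases "n - k + j < i") (auto intro!: mult_right_mono)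
  qed
  finally show ?thesis using c(1) by simp
qed

text \<open>The top \<open>k\<close> eigenvalues of the compressed matrix dominate the bottom \<open>k\<close> eigenvalues of
  \<open>M\<^sup>* A M\<close> one by one, and its remaining eigenvalues contribute nonnegative terms.\<close>

lemma compressed_eigenvalue_sum_le:
  fixes f :: "real \<Rightarrow> real"
  assumes f: "mono_on {0..} f" "f 0 = 0" and A: "A \<in> hermitian_psd n" and M: "M \<in> carrier_mat n n"
    and k: "k \<le> n" and G: "G \<in> rank_idempotents n k"
    and e: "orthonormal_eigenbasis (mat_adjoint M * A * M) l u"
    and srt: "\<And>i j. i \<le> j \<Longrightarrow> j < n \<Longrightarrow> l i \<le> l j"
  shows "(\<Sum>i<k. f (l i)) \<le> Re (mat_trace (mat_fun f (mat_adjoint M * mat_adjoint G * A * G * M)))"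
proof -
  have Gc: "G \<in> carrier_mat n n" "G * G = G" "vec_space.rank n G = k"
    using G unfolding rank_idempotents_def by auto
  have Ac: "A \<in> carrier_mat n n" using A unfolding hermitian_psd_def by simp
  have GM: "G * M \<in> carrier_mat n n" using Gc M by simp
  define X where "X = mat_adjoint M * A * M"
  define Y where "Y = mat_adjoint (G * M) * A * (G * M)"
  have Xp: "X \<in> hermitian_psd n" unfolding X_def by (rule hermitian_psd_congruence[OF A M])
  have Yp: "Y \<in> hermitian_psd n" unfolding Y_def by (rule hermitian_psd_congruence[OF A GM])
  have X: "X \<in> carrier_mat n n" "mat_adjoint X = X" and Y: "Y \<in> carrier_mat n n" "mat_adjoint Y = Y"
    using Xp Yp unfolding hermitian_psd_def by auto
  have eX: "orthonormal_eigenbasis X l u" using e unfolding X_def .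
  obtain m v where eY: "orthonormal_eigenbasis Y m v" and sY: "\<And>i j. i \<le> j \<Longrightarrow> j < n \<Longrightarrow> m i \<le> m j"
    using hermitian_eigenbasis_exists[OF Y] by blast
  obtain B where B: "B \<in> carrier_mat n k" "G * B = B"
    and inj: "\<And>z. z \<in> carrier_vec k \<Longrightarrow> B *\<^sub>v z = 0\<^sub>v n \<Longrightarrow> z = 0\<^sub>v k"
    using idempotent_range_basis[OF Gc] by blast
  have agree: "(X *\<^sub>v x) \<bullet>c x = (Y *\<^sub>v x) \<bullet>c x"
    if x: "x \<in> carrier_vec n" and z: "z \<in> carrier_vec k" and eq: "M *\<^sub>v x = B *\<^sub>v z" for x z
  proof -
    have "(G * M) *\<^sub>v x = G *\<^sub>v (B *\<^sub>v z)" unfolding assoc_mult_mat_vec[OF Gc(1) M x] eq ..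
    also have "\<dots> = M *\<^sub>v x" unfolding assoc_mult_mat_vec[OF Gc(1) B(1) z, symmetric] B(2) eq ..
    finally show ?thesis
      unfolding X_def Y_def congruence_form[OF Ac M x x] congruence_form[OF Ac GM x x] by simp
  qed
  note l0 = psd_eigenvalue_nonneg[OF Xp eX] and m0 = psd_eigenvalue_nonneg[OF Yp eY]
  have "(\<Sum>i<k. f (l i)) \<le> (\<Sum>i<k. f (m (n - k + i)))"
  proof (rule sum_mono)
    fix j assume "j \<in> {..<k}"
    then have j: "j < k" by simp
    have "l j \<le> m (n - k + j)"
      by (rule eigenvalue_interlacing[OF X eX srt Y eY sY M B(1) inj agree j k])
    then show "f (l j) \<le> f (m (n - k + j))"
      using l0[of j] m0[of "n - k + j"] j k by (intro mono_onD[OF f(1)]) auto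
  qed
  also have "\<dots> \<le> (\<Sum>i<n - k. f (m i)) + (\<Sum>i<k. f (m (n - k + i)))"
  proof -
    have "0 \<le> f (m i)" if "i < n - k" for i
      using mono_onD[OF f(1), of 0 "m i"] m0[of i] that f(2) by simp
    then have "0 \<le> (\<Sum>i<n - k. f (m i))" by (intro sum_nonneg) simp
    then show ?thesis by simp
  qed
  also have "\<dots> = (\<Sum>i<n. f (m i))"
    using sum_lessThan_append[of "\<lambda>i. f (m i)" "n - k" k] k by simp
  also have "\<dots> = Re (mat_trace (mat_fun f Y))" using mat_fun_eigenvalues(2)[OF Y eY] by simp
  finally show ?thesis unfolding Y_def congruence_product[OF Ac Gc(1) M] .
qed

section \<open>A minimising idempotent\<close>

lemma sorted_zeros_initial:
  fixes t :: "nat \<Rightarrow> real"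
  assumes "\<And>i. i < n \<Longrightarrow> 0 \<le> t i" and "\<And>i j. i \<le> j \<Longrightarrow> j < n \<Longrightarrow> t i \<le> t j"
  shows "\<exists>d\<le>n. \<forall>i<n. t i = 0 \<longleftrightarrow> i < d"
  using assms
proof (induction n)
  case (Suc n)
  then obtain d where d: "d \<le> n" "\<forall>i<n. t i = 0 \<longleftrightarrow> i < d" by fastforce
  show ?case
  proof (cases "t n = 0")
    case True
    have "t i = 0" if "i < Suc n" for i
      using Suc.prems(1)[OF that] Suc.prems(2)[of i n] that True by simp
    then show ?thesis by (intro exI[of _ "Suc n"]) simp
  next
    case False
    then show ?thesis using d by (intro exI[of _ d]) (auto simp: less_Suc_eq)
  qed
qed simp

text \<open>The right singular vectors \<open>w i\<close> are eigenvectors of \<open>M\<^sup>* M\<close>. Their images are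
  pairwise orthogonal; the nonzero ones are normalised and completed to an orthonormal basis. Singular
  values are in increasing order, so the kernel of \<open>M\<close> is spanned by the first \<open>d\<close> vectors.\<close>

lemma singular_value_decomposition:
  fixes M :: "complex mat"
  assumes M: "M \<in> carrier_mat n n"
  shows "\<exists>s w z d. orthonormal_on n {..<n} w \<and> orthonormal_on n {..<n} z \<and> d \<le> n \<and>
    (\<forall>i<n. M *\<^sub>v w i = complex_of_real (s i) \<cdot>\<^sub>v z i \<and> (s i = 0 \<longleftrightarrow> i < d))"
proof -
  define K where "K = mat_adjoint M * 1\<^sub>m n * M"
  have Kp: "K \<in> hermitian_psd n"
    unfolding K_def by (rule hermitian_psd_congruence[OF one_mat_hermitian_psd M])
  then have K: "K \<in> carrier_mat n n" "mat_adjoint K = K" unfolding hermitian_psd_def by auto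
  obtain t w where e: "orthonormal_eigenbasis K t w" and srt: "\<And>i j. i \<le> j \<Longrightarrow> j < n \<Longrightarrow> t i \<le> t j"
    using hermitian_eigenbasis_exists[OF K] by blast
  have ow: "orthonormal_on n {..<n} w" and eig: "\<And>i. i < n \<Longrightarrow> K *\<^sub>v w i = complex_of_real (t i) \<cdot>\<^sub>v w i"
    using e unfolding orthonormal_eigenbasis_iff[OF K(1)] by auto
  have wc: "w i \<in> carrier_vec n" if "i < n" for i using orthonormal_onD(1)[OF ow] that by simp
  have Mwc: "M *\<^sub>v w i \<in> carrier_vec n" if "i < n" for i using M wc[OF that] by simp
  note t0 = psd_eigenvalue_nonneg[OF Kp e]
  obtain d where d: "d \<le> n" "\<And>i. i < n \<Longrightarrow> t i = 0 \<longleftrightarrow> i < d"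
    using sorted_zeros_initial[of n t, OF t0 srt] by blast
  have ip: "(M *\<^sub>v w i) \<bullet>c (M *\<^sub>v w j) = (if i = j then complex_of_real (t i) else 0)" if "i < n" "j < n" for i j
  proof -
    have "(M *\<^sub>v w i) \<bullet>c (M *\<^sub>v w j) = (K *\<^sub>v w i) \<bullet>c w j"
      unfolding K_def congruence_form[OF one_carrier_mat M wc[OF that(1)] wc[OF that(2)]]
      using Mwc[OF that(1)] by simp
    then show ?thesis
      unfolding eig[OF that(1)] cscalar_smult_left[OF wc[OF that(1)] wc[OF that(2)]]
      using orthonormal_onD(2)[OF ow, of i j] that by simp
  qed
  define s where "s i = sqrt (t i)" for i
  \<comment> \<open>Only used for \<open>i \<ge> d\<close>, where \<open>s i \<noteq> 0\<close>.\<close>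
  define z0 where "z0 i = complex_of_real (1 / s i) \<cdot>\<^sub>v (M *\<^sub>v w i)" for i
  have "orthonormal_on n {d..<n} z0"
    unfolding orthonormal_on_def
  proof (intro conjI ballI)
    fix i assume "i \<in> {d..<n}"
    then have i: "i < n" by simp
    show "z0 i \<in> carrier_vec n" unfolding z0_def using Mwc[OF i] by simp
    fix j assume "j \<in> {d..<n}"
    then have j: "j < n" "t j \<noteq> 0" using d(2) by auto
    have z0j: "z0 j \<in> carrier_vec n" unfolding z0_def using Mwc[OF j(1)] by simp
    have ss: "s j * s j = t j" "s j \<noteq> 0" unfolding s_def using t0[OF j(1)] j by auto
    then have "1 / s j * (1 / s j * t j) = 1" unfolding ss(1)[symmetric] by simp
    then have 1: "complex_of_real (1 / s j) * (complex_of_real (1 / s j) * complex_of_real (t j)) = 1"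
      by (metis of_real_1 of_real_mult)
    have "z0 i \<bullet>c z0 j = complex_of_real (1 / s i) *
        (complex_of_real (1 / s j) * ((M *\<^sub>v w i) \<bullet>c (M *\<^sub>v w j)))"
      using cscalar_smult_left[OF Mwc[OF i] z0j] cscalar_smult_right[OF Mwc[OF i] Mwc[OF j(1)]]
      unfolding z0_def by (simp only: complex_cnj_complex_of_real)
    then show "z0 i \<bullet>c z0 j = (if i = j then 1 else 0)" using 1 unfolding ip[OF i j(1)] by simp
  qed
  then obtain z where oz: "orthonormal_on n {..<n} z" and z: "\<And>i. i \<in> {d..<n} \<Longrightarrow> z i = z0 i"
    using orthonormal_extend[of n "{d..<n}" z0] by fastforce
  have "M *\<^sub>v w i = complex_of_real (s i) \<cdot>\<^sub>v z i" if i: "i < n" for i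
  proof (cases "i < d")
    case True
    then have "t i = 0" using d(2) i by simp
    then have "(M *\<^sub>v w i) \<bullet>c (M *\<^sub>v w i) = 0" using ip[OF i i] by simp
    then have "M *\<^sub>v w i = 0\<^sub>v n" using cscalar_self_nonzero[OF Mwc[OF i]] by fastforce
    moreover have "complex_of_real (s i) \<cdot>\<^sub>v z i = 0\<^sub>v n"
      using orthonormal_onD(1)[OF oz, of i] i \<open>t i = 0\<close> unfolding s_def by auto
    ultimately show ?thesis by simp
  next
    case False
    then have "s i \<noteq> 0" using d(2)[OF i] unfolding s_def by simp
    moreover have "z i = z0 i" using z False i by simp
    ultimately show ?thesis unfolding z0_def by (simp add: smult_smult_assoc flip: of_real_mult)
  qed
  moreover have "s i = 0 \<longleftrightarrow> i < d" if "i < n" for i using d(2)[OF that] unfolding s_def by simp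
  ultimately show ?thesis using ow oz d(1) by blast
qed

text \<open>Replacing the vanishing singular values of \<open>M\<close> by \<open>1\<close> gives an invertible matrix, and
  alters \<open>M\<close> on its kernel only. The first \<open>d\<close> vectors \<open>w i\<close> span that kernel.\<close>

lemma invertible_agreeing_off_kernel:
  fixes M :: "complex mat"
  assumes M: "M \<in> carrier_mat n n"
  shows "\<exists>N N' w d. N \<in> carrier_mat n n \<and> N' \<in> carrier_mat n n \<and> N' * N = 1\<^sub>m n \<and>
    d \<le> n \<and> orthonormal_on n {..<d} w \<and> (\<forall>i<d. M *\<^sub>v w i = 0\<^sub>v n) \<and>
    (\<forall>x\<in>carrier_vec n. (\<forall>i<d. x \<bullet>c w i = 0) \<longrightarrow> M *\<^sub>v x = N *\<^sub>v x)"
proof -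
  obtain s w z d where ow: "orthonormal_on n {..<n} w" and oz: "orthonormal_on n {..<n} z" and d: "d \<le> n"
    and Mw: "\<And>i. i < n \<Longrightarrow> M *\<^sub>v w i = complex_of_real (s i) \<cdot>\<^sub>v z i"
    and s: "\<And>i. i < n \<Longrightarrow> s i = 0 \<longleftrightarrow> i < d"
    using singular_value_decomposition[OF M] by blast
  have wc: "w i \<in> carrier_vec n" and zc: "z i \<in> carrier_vec n" if "i < n" for i
    using orthonormal_onD(1)[OF ow] orthonormal_onD(1)[OF oz] that by auto
  define s' where "s' i = (if i < d then 1 else s i)" for i
  have s'0: "s' i \<noteq> 0" if "i < n" for i using s[OF that] unfolding s'_def by simp
  define N where "N = mat n n (\<lambda>(r, c). \<Sum>i<n. complex_of_real (s' i) * z i $ r * cnj (w i $ c))"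
  have N: "N \<in> carrier_mat n n" unfolding N_def by simp
  have Nx: "(N *\<^sub>v x) $ r = (\<Sum>i<n. (x \<bullet>c w i) * (complex_of_real (s' i) * z i $ r))"
    if x: "x \<in> carrier_vec n" and r: "r < n" for x r
  proof -
    have "(N *\<^sub>v x) $ r = (\<Sum>c<n. \<Sum>i<n. complex_of_real (s' i) * z i $ r * cnj (w i $ c) * x $ c)"
      unfolding mult_mat_vec_sum[OF N x r] using r by (simp add: N_def sum_distrib_right)
    also have "\<dots> = (\<Sum>i<n. (x \<bullet>c w i) * (complex_of_real (s' i) * z i $ r))"
      by (subst sum.swap) (simp add: cscalar_sum[OF wc] sum_distrib_right sum_distrib_left mult_ac)
    finally show ?thesis .
  qed
  have Nz: "(N *\<^sub>v x) \<bullet>c z j = complex_of_real (s' j) * (x \<bullet>c w j)" if x: "x \<in> carrier_vec n" and j: "j < n" for x j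
  proof -
    have "(N *\<^sub>v x) \<bullet>c z j = (\<Sum>r<n. \<Sum>i<n. (x \<bullet>c w i) * (complex_of_real (s' i) * z i $ r) * cnj (z j $ r))"
      unfolding cscalar_sum[OF zc[OF j]] by (simp add: Nx[OF x] sum_distrib_right)
    also have "\<dots> = (\<Sum>i<n. (x \<bullet>c w i) * complex_of_real (s' i) * (z i \<bullet>c z j))"
      by (subst sum.swap) (simp add: cscalar_sum[OF zc[OF j]] sum_distrib_left mult_ac)
    also have "\<dots> = (\<Sum>i<n. if i = j then (x \<bullet>c w i) * complex_of_real (s' i) else 0)"
      by (intro sum.cong refl) (use orthonormal_onD(2)[OF oz] j in auto)
    finally show ?thesis using j by (simp add: mult.commute)
  qed
  have "det N \<noteq> 0"
  proof
    assume "det N = 0"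
    then obtain x where x: "x \<in> carrier_vec n" "x \<noteq> 0\<^sub>v n" "N *\<^sub>v x = 0\<^sub>v n"
      using det_0_iff_vec_prod_zero_field[OF N] by auto
    have "x \<bullet>c w j = 0\<^sub>v n \<bullet>c w j" if j: "j < n" for j
    proof -
      have "complex_of_real (s' j) * (x \<bullet>c w j) = 0"
        unfolding Nz[OF x(1) j, symmetric] x(3) cscalar_sum[OF zc[OF j]] by simp
      then show ?thesis using s'0[OF j] unfolding cscalar_sum[OF wc[OF j], of "0\<^sub>v n"] by simp
    qed
    then have "x = 0\<^sub>v n" by (intro orthonormal_vec_eqI[OF ow x(1)]) auto
    then show False using x by simp
  qed
  then obtain N' where N': "N' \<in> carrier_mat n n" "N' * N = 1\<^sub>m n"
    using det_non_zero_imp_unit[OF N] unfolding Units_def ring_mat_def by auto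
  have "M *\<^sub>v x = N *\<^sub>v x" if x: "x \<in> carrier_vec n" and xw: "\<forall>i<d. x \<bullet>c w i = 0" for x
  proof (rule eq_vecI)
    fix r assume "r < dim_vec (N *\<^sub>v x)"
    then have r: "r < n" using N by simp
    have "(M *\<^sub>v w i) $ r = complex_of_real (s i) * z i $ r" if "i < n" for i
      using Mw[OF that] zc[OF that] r by simp
    then have "(M *\<^sub>v x) $ r = (\<Sum>i<n. (x \<bullet>c w i) * (complex_of_real (s i) * z i $ r))"
      unfolding mult_mat_vec_expansion[OF M ow x r] by simp
    also have "\<dots> = (N *\<^sub>v x) $ r"
      unfolding Nx[OF x r] by (intro sum.cong refl) (use xw in \<open>auto simp: s'_def\<close>)
    finally show "(M *\<^sub>v x) $ r = (N *\<^sub>v x) $ r" .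
  qed (use M N in simp)
  moreover have "M *\<^sub>v w i = 0\<^sub>v n" if "i < d" for i
  proof -
    have "i < n" "s i = 0" using that d s by auto
    then show ?thesis using Mw[of i] zc[of i] by auto
  qed
  moreover have "orthonormal_on n {..<d} w" using ow d unfolding orthonormal_on_def by auto
  ultimately show ?thesis using N N' d by blast
qed

text \<open>An orthonormal basis of the kernel of \<open>M\<close> consists of eigenvectors of \<open>M\<^sup>* A M\<close> for
  the eigenvalue \<open>0\<close>. Extended to an eigenbasis, all further eigenvectors are orthogonal to the kernel,
  where \<open>M\<close> agrees with \<open>N\<close>. Reordering by eigenvalue preserves the dichotomy, which concerns each
  vector separately.\<close>

lemma adapted_eigenbasis:
  fixes A M :: "complex mat"
  assumes A: "A \<in> hermitian_psd n" and M: "M \<in> carrier_mat n n"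
  shows "\<exists>N N' l u. N \<in> carrier_mat n n \<and> N' \<in> carrier_mat n n \<and> N' * N = 1\<^sub>m n \<and>
    orthonormal_eigenbasis (mat_adjoint M * A * M) l u \<and> (\<forall>i j. i \<le> j \<longrightarrow> j < n \<longrightarrow> l i \<le> l j) \<and>
    (\<forall>i<n. M *\<^sub>v u i = 0\<^sub>v n \<or> M *\<^sub>v u i = N *\<^sub>v u i)"
proof -
  define X where "X = mat_adjoint M * A * M"
  have Xp: "X \<in> hermitian_psd n" unfolding X_def by (rule hermitian_psd_congruence[OF A M])
  then have X: "X \<in> carrier_mat n n" "mat_adjoint X = X" unfolding hermitian_psd_def by auto
  have Ac: "A \<in> carrier_mat n n" using A unfolding hermitian_psd_def by simp
  obtain N N' w d where N: "N \<in> carrier_mat n n" "N' \<in> carrier_mat n n" "N' * N = 1\<^sub>m n"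
    and d: "d \<le> n" and w: "orthonormal_on n {..<d} w" and Mw: "\<And>i. i < d \<Longrightarrow> M *\<^sub>v w i = 0\<^sub>v n"
    and MN: "\<And>x. x \<in> carrier_vec n \<Longrightarrow> (\<forall>i<d. x \<bullet>c w i = 0) \<Longrightarrow> M *\<^sub>v x = N *\<^sub>v x"
    using invertible_agreeing_off_kernel[OF M] by blast
  have "X *\<^sub>v w i = complex_of_real 0 \<cdot>\<^sub>v w i" if i: "i < d" for i
  proof -
    have wc: "w i \<in> carrier_vec n" using orthonormal_onD(1)[OF w] i by simp
    have "X *\<^sub>v w i = (mat_adjoint M * A) *\<^sub>v (M *\<^sub>v w i)"
      unfolding X_def using assoc_mult_mat_vec[OF mult_carrier_mat[OF mat_adjoint_carrier[OF M] Ac] M wc] .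
    also have "\<dots> = 0\<^sub>v n"
      unfolding Mw[OF i] by (rule mult_mat_zero_vec[OF mult_carrier_mat[OF mat_adjoint_carrier[OF M] Ac]])
    also have "0\<^sub>v n = complex_of_real 0 \<cdot>\<^sub>v w i" using wc by auto
    finally show ?thesis .
  qed
  then obtain l u where e: "orthonormal_eigenbasis X l u" and uw: "\<And>i. i < d \<Longrightarrow> u i = w i"
    using spectral_extend[OF X d w, of "\<lambda>_. 0"] by blast
  have o: "orthonormal_on n {..<n} u" using e unfolding orthonormal_eigenbasis_iff[OF X(1)] by simp
  have dich: "M *\<^sub>v u i = 0\<^sub>v n \<or> M *\<^sub>v u i = N *\<^sub>v u i" if i: "i < n" for i
  proof (cases "i < d")
    case True
    then show ?thesis using Mw uw by simp
  next
    case False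
    have "u i \<bullet>c w j = 0" if "j < d" for j
      using orthonormal_onD(2)[OF o, of i j] i False that d uw[OF that] by auto
    then show ?thesis using MN[of "u i"] orthonormal_onD(1)[OF o] i by simp
  qed
  obtain p where p: "p permutes {..<n}" "\<forall>i j. i \<le> j \<longrightarrow> j < n \<longrightarrow> l (p i) \<le> l (p j)"
    using sorting_permutation[of n l] by blast
  have "M *\<^sub>v (u \<circ> p) i = 0\<^sub>v n \<or> M *\<^sub>v (u \<circ> p) i = N *\<^sub>v (u \<circ> p) i" if "i < n" for i
    using dich[of "p i"] permutes_in_image[OF p(1), of i] that by simp
  moreover have "orthonormal_eigenbasis X (l \<circ> p) (u \<circ> p)"
    by (rule orthonormal_eigenbasis_permute[OF X(1) e p(1)])
  ultimately show ?thesis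
    using N p(2) unfolding X_def[symmetric]
    by (intro exI[of _ N] exI[of _ N'] exI[of _ "l \<circ> p"] exI[of _ "u \<circ> p"]) simp
qed

text \<open>The idempotent is \<open>N P N\<^sup>-\<^sup>1\<close> with \<open>P\<close> the orthogonal projection onto the span of
  \<open>u 0, \<dots>, u (k - 1)\<close>. It is written as \<open>B C\<close> with \<open>C B = 1\<close>, which exhibits both idempotence and
  rank. On the vectors \<open>N (u i)\<close> it acts as \<open>P\<close> does on \<open>u i\<close>, and on \<open>M (u i) = 0\<close> there is nothing
  to select.\<close>

lemma idempotent_selecting_eigenvectors:
  fixes M :: "complex mat"
  assumes M: "M \<in> carrier_mat n n" and N: "N \<in> carrier_mat n n" "N' \<in> carrier_mat n n" "N' * N = 1\<^sub>m n"
    and o: "orthonormal_on n {..<n} u"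
    and dich: "\<And>i. i < n \<Longrightarrow> M *\<^sub>v u i = 0\<^sub>v n \<or> M *\<^sub>v u i = N *\<^sub>v u i" and k: "k \<le> n"
  shows "\<exists>G\<in>rank_idempotents n k. \<forall>i<n. (G * M) *\<^sub>v u i = (if i < k then M *\<^sub>v u i else 0\<^sub>v n)"
proof -
  define U where "U = mat n k (\<lambda>(r, i). u i $ r)"
  have U: "U \<in> carrier_mat n k" unfolding U_def by simp
  note Ua = mat_adjoint_carrier[OF U]
  have uc: "u i \<in> carrier_vec n" if "i < n" for i using orthonormal_onD(1)[OF o] that by simp
  have colU: "col U i = u i" if "i < k" for i
    using uc[of i] that k unfolding U_def by (intro eq_vecI) auto
  have Uu: "mat_adjoint U *\<^sub>v u i = (if i < k then unit_vec k i else 0\<^sub>v k)" if i: "i < n" for i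
  proof (rule eq_vecI)
    fix j assume "j < dim_vec (if i < k then unit_vec k i else 0\<^sub>v k :: complex vec)"
    then have j: "j < k" by (simp split: if_splits)
    then have jn: "j < n" using k by simp
    have "mat_adjoint U $$ (j, r) = cnj (u j $ r)" if "r < n" for r
      using mat_adjoint_index[OF U j that] j that unfolding U_def by simp
    then have "(mat_adjoint U *\<^sub>v u i) $ j = u i \<bullet>c u j"
      unfolding mult_mat_vec_sum[OF Ua uc[OF i] j] cscalar_sum[OF uc[OF jn]] by (simp add: mult.commute)
    then show "(mat_adjoint U *\<^sub>v u i) $ j = (if i < k then unit_vec k i else 0\<^sub>v k) $ j"
      using orthonormal_onD(2)[OF o, of i j] i j jn by auto
  qed (use U in simp)
  have UU: "mat_adjoint U * U = 1\<^sub>m k"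
  proof (rule mat_col_eqI)
    fix i assume "i < dim_col (1\<^sub>m k :: complex mat)"
    then have i: "i < k" by simp
    show "col (mat_adjoint U * U) i = col (1\<^sub>m k) i"
      unfolding col_mult2[OF Ua U i] colU[OF i] using Uu[of i] i k by simp
  qed (use U in auto)
  define B where "B = N * U"
  define C where "C = mat_adjoint U * N'"
  have B: "B \<in> carrier_mat n k" and C: "C \<in> carrier_mat k n" unfolding B_def C_def using N U Ua by auto
  have CB: "C * B = 1\<^sub>m k"
  proof -
    have "C * B = mat_adjoint U * (N' * (N * U))"
      unfolding B_def C_def by (rule assoc_mult_mat[OF Ua N(2) mult_carrier_mat[OF N(1) U]])
    also have "N' * (N * U) = (N' * N) * U" by (rule assoc_mult_mat[OF N(2,1) U, symmetric])
    finally show ?thesis unfolding N(3) left_mult_one_mat[OF U] UU .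
  qed
  define G where "G = B * C"
  have G: "G \<in> carrier_mat n n" unfolding G_def using B C by simp
  have "G * G = B * (C * (B * C))" unfolding G_def by (rule assoc_mult_mat[OF B C mult_carrier_mat[OF B C]])
  also have "C * (B * C) = (C * B) * C" by (rule assoc_mult_mat[OF C B C, symmetric])
  also have "\<dots> = C" unfolding CB by (rule left_mult_one_mat[OF C])
  finally have "G * G = G" unfolding G_def .
  then have Gm: "G \<in> rank_idempotents n k"
    using G rank_of_split_factorization[OF B C CB] unfolding rank_idempotents_def G_def by simp
  have "(G * M) *\<^sub>v u i = (if i < k then M *\<^sub>v u i else 0\<^sub>v n)" if i: "i < n" for i
  proof -
    have GM: "(G * M) *\<^sub>v u i = G *\<^sub>v (M *\<^sub>v u i)" by (rule assoc_mult_mat_vec[OF G M uc[OF i]])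
    show ?thesis
    proof (cases "M *\<^sub>v u i = 0\<^sub>v n")
      case True
      moreover have "G *\<^sub>v 0\<^sub>v n = 0\<^sub>v n" using G by auto
      ultimately show ?thesis unfolding GM by simp
    next
      case False
      then have MN: "M *\<^sub>v u i = N *\<^sub>v u i" using dich[OF i] by simp
      have Nu: "N *\<^sub>v u i \<in> carrier_vec n" using N uc[OF i] by simp
      have NNu: "N' *\<^sub>v (N *\<^sub>v u i) = u i"
        using assoc_mult_mat_vec[OF N(2,1) uc[OF i]] N(3) uc[OF i] by simp
      have "C *\<^sub>v (N *\<^sub>v u i) = mat_adjoint U *\<^sub>v u i"
        unfolding C_def assoc_mult_mat_vec[OF Ua N(2) Nu] NNu ..
      then have GN: "G *\<^sub>v (N *\<^sub>v u i) = B *\<^sub>v (if i < k then unit_vec k i else 0\<^sub>v k)"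
        unfolding G_def assoc_mult_mat_vec[OF B C Nu] Uu[OF i] by simp
      show ?thesis
      proof (cases "i < k")
        case True
        have "B *\<^sub>v unit_vec k i = col (B * 1\<^sub>m k) i" using col_mult2[OF B _ True, of "1\<^sub>m k"] True by simp
        also have "\<dots> = col B i" using B by simp
        also have "\<dots> = N *\<^sub>v u i" unfolding B_def col_mult2[OF N(1) U True] colU[OF True] ..
        finally show ?thesis unfolding GM MN GN using True by simp
      next
        case False
        have "B *\<^sub>v 0\<^sub>v k = 0\<^sub>v n" using B by auto
        then show ?thesis unfolding GM MN GN using False by simp
      qed
    qed
  qed
  then show ?thesis using Gm by blast
qed

text \<open>The vectors \<open>u i\<close> are also eigenvectors of the compressed matrix: its sesquilinear form
  is that of \<open>M\<^sup>* A M\<close> on the first \<open>k\<close> of them and zero on the others, whose eigenvalue \<open>0\<close> adds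
  \<open>f 0 = 0\<close> to the trace.\<close>

lemma compressed_eigenvalue_sum_attained:
  fixes f :: "real \<Rightarrow> real"
  assumes f0: "f 0 = 0" and A: "A \<in> hermitian_psd n" and M: "M \<in> carrier_mat n n" and k: "k \<le> n"
    and X: "X = mat_adjoint M * A * M" and e: "orthonormal_eigenbasis X l u"
    and G: "G \<in> carrier_mat n n"
    and GM: "\<And>i. i < n \<Longrightarrow> (G * M) *\<^sub>v u i = (if i < k then M *\<^sub>v u i else 0\<^sub>v n)"
  shows "Re (mat_trace (mat_fun f (mat_adjoint M * mat_adjoint G * A * G * M))) = (\<Sum>i<k. f (l i))"
proof -
  have Ac: "A \<in> carrier_mat n n" using A unfolding hermitian_psd_def by simp
  have GMc: "G * M \<in> carrier_mat n n" using G M by simp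
  define Y where "Y = mat_adjoint (G * M) * A * (G * M)"
  have Yp: "Y \<in> hermitian_psd n" unfolding Y_def by (rule hermitian_psd_congruence[OF A GMc])
  have Y: "Y \<in> carrier_mat n n" "mat_adjoint Y = Y" using Yp unfolding hermitian_psd_def by auto
  have Xc: "X \<in> carrier_mat n n"
    using hermitian_psd_congruence[OF A M] unfolding X hermitian_psd_def by simp
  have o: "orthonormal_on n {..<n} u" and eig: "\<And>i. i < n \<Longrightarrow> X *\<^sub>v u i = complex_of_real (l i) \<cdot>\<^sub>v u i"
    using e unfolding orthonormal_eigenbasis_iff[OF Xc] by auto
  have uc: "u i \<in> carrier_vec n" if "i < n" for i using orthonormal_onD(1)[OF o] that by simp
  define m where "m i = (if i < k then l i else 0)" for i
  have Yu: "Y *\<^sub>v u i = complex_of_real (m i) \<cdot>\<^sub>v u i" if i: "i < n" for i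
  proof (rule orthonormal_vec_eqI[OF o])
    show "Y *\<^sub>v u i \<in> carrier_vec n" "complex_of_real (m i) \<cdot>\<^sub>v u i \<in> carrier_vec n"
      using Y uc[OF i] by auto
    fix j assume j: "j < n"
    have uu: "u i \<bullet>c u j = (if i = j then 1 else 0)" using orthonormal_onD(2)[OF o] i j by simp
    have Mu: "M *\<^sub>v u i \<in> carrier_vec n" "M *\<^sub>v u j \<in> carrier_vec n" using M uc i j by auto
    have "(Y *\<^sub>v u i) \<bullet>c u j = (A *\<^sub>v (if i < k then M *\<^sub>v u i else 0\<^sub>v n)) \<bullet>c (if j < k then M *\<^sub>v u j else 0\<^sub>v n)"
      unfolding Y_def congruence_form[OF Ac GMc uc[OF i] uc[OF j]] GM[OF i] GM[OF j] ..
    also have "\<dots> = (if i < k \<and> j < k then (A *\<^sub>v (M *\<^sub>v u i)) \<bullet>c (M *\<^sub>v u j) else 0)"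
    proof -
      have "A *\<^sub>v 0\<^sub>v n = 0\<^sub>v n" using Ac by auto
      moreover have "0\<^sub>v n \<bullet>c y = 0" if "y \<in> carrier_vec n" for y :: "complex vec"
        unfolding cscalar_sum[OF that] by simp
      moreover have "y \<bullet>c 0\<^sub>v n = 0" for y :: "complex vec"
        unfolding cscalar_sum[OF zero_carrier_vec] by simp
      ultimately show ?thesis using Mu by simp
    qed
    also have "(A *\<^sub>v (M *\<^sub>v u i)) \<bullet>c (M *\<^sub>v u j) = complex_of_real (l i) * (u i \<bullet>c u j)"
      unfolding congruence_form[OF Ac M uc[OF i] uc[OF j], symmetric] X[symmetric] eig[OF i]
      by (rule cscalar_smult_left[OF uc[OF i] uc[OF j]])
    finally show "(Y *\<^sub>v u i) \<bullet>c u j = (complex_of_real (m i) \<cdot>\<^sub>v u i) \<bullet>c u j"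
      unfolding cscalar_smult_left[OF uc[OF i] uc[OF j]] uu m_def by auto
  qed
  then have "orthonormal_eigenbasis Y m u" unfolding orthonormal_eigenbasis_iff[OF Y(1)] using o by simp
  then have "Re (mat_trace (mat_fun f Y)) = (\<Sum>i<n. f (m i))" by (rule mat_fun_eigenvalues(2)[OF Y])
  also have "\<dots> = (\<Sum>i<k. f (l i))"
    by (rule sum.mono_neutral_cong_right) (use k f0 in \<open>auto simp: m_def\<close>)
  finally show ?thesis unfolding Y_def congruence_product[OF Ac G M] .
qed

section \<open>The variational formula\<close>

theorem lemma2p8:
  fixes f :: "real \<Rightarrow> real" and A M :: "complex mat" and n k :: nat
  assumes "mono_on {0..} f"
    and "f 0 = 0"
    and "A \<in> hermitian_psd n"
    and "M \<in> carrier_mat n n"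
    and "1 \<le> k" and "k \<le> n"
  shows "(\<Sum>i = 1..k. eigval_up (mat_fun f (mat_adjoint M * A * M)) i) =
           (INF G \<in> rank_idempotents n k.
              Re (mat_trace (mat_fun f (mat_adjoint M * mat_adjoint G * A * G * M)))) \<and>
         (invertible_mat M \<longrightarrow>
           (\<exists>G \<in> rank_idempotents n k.
              Re (mat_trace (mat_fun f (mat_adjoint M * mat_adjoint G * A * G * M))) =
              (INF G \<in> rank_idempotents n k.
                 Re (mat_trace (mat_fun f (mat_adjoint M * mat_adjoint G * A * G * M))))))"
proof -
  define X where "X = mat_adjoint M * A * M"
  define F where "F G = Re (mat_trace (mat_fun f (mat_adjoint M * mat_adjoint G * A * G * M)))" for G
  have Xp: "X \<in> hermitian_psd n" unfolding X_def by (rule hermitian_psd_congruence[OF assms(3,4)])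
  then have X: "X \<in> carrier_mat n n" "mat_adjoint X = X" unfolding hermitian_psd_def by auto
  obtain N N' l u where N: "N \<in> carrier_mat n n" "N' \<in> carrier_mat n n" "N' * N = 1\<^sub>m n"
    and e: "orthonormal_eigenbasis X l u" and srt: "\<And>i j. i \<le> j \<Longrightarrow> j < n \<Longrightarrow> l i \<le> l j"
    and dich: "\<And>i. i < n \<Longrightarrow> M *\<^sub>v u i = 0\<^sub>v n \<or> M *\<^sub>v u i = N *\<^sub>v u i"
    using adapted_eigenbasis[OF assms(3,4)] unfolding X_def by blast
  have o: "orthonormal_on n {..<n} u" using e unfolding orthonormal_eigenbasis_iff[OF X(1)] by simp
  have fl: "f (l i) \<le> f (l j)" if "i \<le> j" "j < n" for i j
    using srt[OF that] psd_eigenvalue_nonneg[OF Xp e] that by (intro mono_onD[OF assms(1)]) auto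
  have lhs: "(\<Sum>i = 1..k. eigval_up (mat_fun f X) i) = (\<Sum>i<k. f (l i))"
  proof -
    have "(\<Sum>i = 1..k. eigval_up (mat_fun f X) i) = (\<Sum>i = 1..k. f (l (i - 1)))"
      using assms(6) by (intro sum.cong refl eigval_up_mat_fun[where f = f, OF X e fl]) auto
    also have "\<dots> = (\<Sum>i<k. f (l i))"
      by (rule sum.reindex_bij_witness[of _ Suc "\<lambda>i. i - 1"]) auto
    finally show ?thesis .
  qed
  obtain G where G: "G \<in> rank_idempotents n k"
    and GM: "\<And>i. i < n \<Longrightarrow> (G * M) *\<^sub>v u i = (if i < k then M *\<^sub>v u i else 0\<^sub>v n)"
    using idempotent_selecting_eigenvectors[where u = u, OF assms(4) N o dich assms(6)] by blast
  have Gc: "G \<in> carrier_mat n n" using G unfolding rank_idempotents_def by simp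
  have FG: "F G = (\<Sum>i<k. f (l i))"
    unfolding F_def
    by (rule compressed_eigenvalue_sum_attained[where f = f and u = u, OF assms(2,3,4,6) X_def e Gc GM])
  have le: "(\<Sum>i<k. f (l i)) \<le> F G'" if "G' \<in> rank_idempotents n k" for G'
    unfolding F_def
    by (rule compressed_eigenvalue_sum_le[where l = l and u = u, OF assms(1-4,6) that e[unfolded X_def] srt])
  have "Inf (F ` rank_idempotents n k) = F G"
  proof (rule cInf_eq_minimum)
    show "F G \<in> F ` rank_idempotents n k" using G by (rule imageI)
    show "F G \<le> y" if "y \<in> F ` rank_idempotents n k" for y using that le FG by auto
  qed
  then show ?thesis using G FG lhs unfolding F_def X_def by auto
qed

end
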